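(* Let $f\in\mathcal{O}=\mathbb{C}\{x,y\}$ be a reduced local equation around $0$ of a plane curve $D\subset\mathbb{C}^2$, and suppose that $f$ is not a product. If $f\in\mathfrak{m}^3$ and $\delta$ is a singular logarithmic derivation for $f$ such that $\delta(f)\in\mathfrak{m}f$, then $\delta$ is topologically nilpotent.
   Context: $\mathfrak m=\langle x,y\rangle$ is the maximal ideal of $\mathcal O$; $\operatorname{Der}$ is the $\mathcal O$-module of $\mathbb{C}$-derivations of $\mathcal{O}$. "Reduced" means without repeated factors. A derivation $\delta$ is logarithmic for $f$ if $\delta(f)\in\langle f\rangle$; $\operatorname{Der}_f\subset\operatorname{Der}$ is the module of logarithmic derivations for $f$. A derivation is singular if it belongs to $\mathfrak{m}\operatorname{Der}$, i.e. its coefficients lie in $\mathfrak m$. $f$ is a product if $\operatorname{Der}_f\not\subset\mathfrak m\operatorname{Der}$. A singular derivation $\delta$, extended to $\widehat{\mathcal O}=\mathbb{C}[[x,y]]$ with maximal ideal $\widehat{\mathfrak m}$, is topologically nilpotent if for every $h\in\widehat{\mathcal O}$ the sequence $(\delta^m(h))_m$ tends to $0$ in the $\widehat{\mathfrak m}$-adic topology. *)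

theory Defs
  imports "HOL-Analysis.Analysis" "HOL-Computational_Algebra.Squarefree"
begin

unbundle no vec_syntax and fps_syntax

text \<open>
  The ring of formal power series in $x, y$ is the type \<open>complex fps fps\<close>: the inner variable is
  $x$, the outer one is $y$, so that \<open>h $ j $ i\<close> is the coefficient of $x^i y^j$ in \<open>h\<close>.
\<close>

type_synonym formal_series = "complex fps fps"

definition formal_x :: formal_series where "formal_x = fps_const fps_X"
definition formal_y :: formal_series where "formal_y = fps_X"
definition formal_const :: "complex \<Rightarrow> formal_series" where
  "formal_const c = fps_const (fps_const c)"

definition convergent_near_0 :: "formal_series \<Rightarrow> bool" where
  "convergent_near_0 h \<longleftrightarrow>
     (\<exists>r>0. \<forall>z w :: complex. norm z < r \<longrightarrow> norm w < r \<longrightarrow>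
        (\<lambda>(i, j). h $ j $ i * z ^ i * w ^ j) summable_on UNIV)"

lemma convergent_near_0_iff_bound:
  "convergent_near_0 h \<longleftrightarrow> (\<exists>C R. C > 0 \<and> R > 0 \<and> (\<forall>i j. norm (h $ j $ i) \<le> C * R ^ (i + j)))"
proof
  assume "convergent_near_0 h"
  then obtain r where r: "r > 0" and conv: "\<And>z w :: complex. norm z < r \<Longrightarrow> norm w < r \<Longrightarrow>
        (\<lambda>(i, j). h $ j $ i * z ^ i * w ^ j) summable_on UNIV"
    unfolding convergent_near_0_def by blast
  define z :: complex where "z = of_real (r / 2)"
  have nz: "norm z = r / 2" using r by (simp add: z_def)
  let ?g = "\<lambda>(i, j). h $ j $ i * z ^ i * z ^ j"
  have "?g summable_on UNIV" using conv[of z z] nz r by auto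
  then have abs: "(\<lambda>p. norm (?g p)) summable_on UNIV"
    by (simp add: summable_on_iff_abs_summable_on_complex)
  define S where "S = infsum (\<lambda>p. norm (?g p)) UNIV"
  have S: "norm (?g p) \<le> S" for p
    using finite_sum_le_infsum[OF abs, of "{p}"] by (simp add: S_def)
  have "norm (h $ j $ i) \<le> (S + 1) * (2 / r) ^ (i + j)" for i j
  proof -
    have "norm (h $ j $ i) * (r / 2) ^ (i + j) \<le> S"
      using S[of "(i, j)"] nz by (simp add: norm_mult norm_power power_add mult.assoc)
    also have "\<dots> \<le> S + 1" by simp
    finally have "norm (h $ j $ i) \<le> (S + 1) / (r / 2) ^ (i + j)"
      using r by (simp add: pos_le_divide_eq)
    also have "\<dots> = (S + 1) * (2 / r) ^ (i + j)"
      by (simp add: power_divide)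
    finally show ?thesis .
  qed
  moreover have "S + 1 > 0" using S[of "(0, 0)"] norm_ge_zero[of "?g (0, 0)"] by linarith
  ultimately show "\<exists>C R. C > 0 \<and> R > 0 \<and> (\<forall>i j. norm (h $ j $ i) \<le> C * R ^ (i + j))"
    using r by (intro exI[of _ "S + 1"] exI[of _ "2 / r"]) auto
next
  assume "\<exists>C R. C > 0 \<and> R > 0 \<and> (\<forall>i j. norm (h $ j $ i) \<le> C * R ^ (i + j))"
  then obtain C R :: real where CR: "C > 0" "R > 0"
    and b: "\<And>i j. norm (h $ j $ i) \<le> C * R ^ (i + j)" by blast
  show "convergent_near_0 h" unfolding convergent_near_0_def
  proof (intro exI[of _ "1 / R"] conjI allI impI)
    fix z w :: complex assume z: "norm z < 1 / R" and w: "norm w < 1 / R"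
    define s t where "s = R * norm z" and "t = R * norm w"
    have st: "0 \<le> s" "s < 1" "0 \<le> t" "t < 1"
      using z w CR by (auto simp: s_def t_def field_simps)
    have S1: "(\<lambda>i. s ^ i) summable_on UNIV" and S2: "(\<lambda>i. t ^ i) summable_on UNIV"
      using st by (auto intro!: norm_summable_imp_summable_on summable_geometric simp: norm_power)
    have row: "((\<lambda>j. s ^ i * t ^ j) has_sum (s ^ i * (\<Sum>\<^sub>\<infinity>j. t ^ j))) UNIV" for i
      using S2 by (intro has_sum_cmult_right) (simp add: has_sum_infsum)
    have "(\<lambda>(i, j). s ^ i * t ^ j) summable_on (UNIV \<times> UNIV)"
      by (rule summable_on_SigmaI[where g = "\<lambda>i. s ^ i * (\<Sum>\<^sub>\<infinity>j. t ^ j)"])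
         (use row st summable_on_cmult_left[OF S1] in simp_all)
    then have "(\<lambda>p. C * (case p of (i, j) \<Rightarrow> s ^ i * t ^ j)) summable_on UNIV"
      by (intro summable_on_cmult_right) simp
    then have "(\<lambda>p. norm ((\<lambda>(i, j). h $ j $ i * z ^ i * w ^ j) p)) summable_on UNIV"
    proof (rule summable_on_comparison_test)
      fix p :: "nat \<times> nat"
      obtain i j where p: "p = (i, j)" by force
      have "norm (h $ j $ i) * (norm z ^ i * norm w ^ j)
          \<le> C * R ^ (i + j) * (norm z ^ i * norm w ^ j)"
        by (rule mult_right_mono[OF b]) simp
      then show "norm ((\<lambda>(i, j). h $ j $ i * z ^ i * w ^ j) p)
          \<le> C * (case p of (i, j) \<Rightarrow> s ^ i * t ^ j)"
        by (simp add: p norm_mult norm_power s_def t_def power_mult_distrib power_add mult_ac)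
    qed auto
    then show "(\<lambda>(i, j). h $ j $ i * z ^ i * w ^ j) summable_on UNIV"
      by (rule abs_summable_summable)
  qed (use CR in auto)
qed

lemma convergent_near_0I:
  assumes "\<And>i j. norm (h $ j $ i) \<le> C * R ^ (i + j)" "C > 0" "R > 0"
  shows "convergent_near_0 h"
  using assms convergent_near_0_iff_bound by blast

lemma convergent_near_0E:
  assumes "convergent_near_0 h"
  obtains C R where "C > 0" "R \<ge> 1" "\<And>i j. norm (h $ j $ i) \<le> C * R ^ (i + j)"
proof -
  obtain C R where *: "C > 0" "R > 0" "\<And>i j. norm (h $ j $ i) \<le> C * R ^ (i + j)"
    using assms convergent_near_0_iff_bound by blast
  have "norm (h $ j $ i) \<le> C * (max 1 R) ^ (i + j)" for i j
    by (rule order_trans[OF *(3)] mult_left_mono power_mono)+ (use * in auto)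
  with * that[of C "max 1 R"] show ?thesis by auto
qed

lemma convergent_near_0_finite_support:
  assumes "finite {(i, j). h $ j $ i \<noteq> 0}"
  shows "convergent_near_0 h"
proof (rule convergent_near_0I[where R = 1])
  let ?A = "{(i, j). h $ j $ i \<noteq> 0}"
  let ?C = "(\<Sum>(i, j)\<in>?A. norm (h $ j $ i)) + 1"
  have nn: "(\<Sum>(i, j)\<in>?A. norm (h $ j $ i)) \<ge> 0" by (rule sum_nonneg) auto
  then show "?C > 0" by linarith
  show "norm (h $ j $ i) \<le> ?C * 1 ^ (i + j)" for i j
  proof (cases "h $ j $ i = 0")
    case False
    then have "norm (h $ j $ i) \<le> (\<Sum>(i, j)\<in>?A. norm (h $ j $ i))"
      using member_le_sum[of "(i, j)" ?A "\<lambda>(i, j). norm (h $ j $ i)"] assms by auto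
    then show ?thesis by simp
  qed (use nn in simp)
qed simp

lemma convergent_near_0_const: "convergent_near_0 (formal_const c)"
  by (rule convergent_near_0_finite_support, rule finite_subset[of _ "{(0, 0)}"])
     (auto simp: formal_const_def split: if_splits)

lemma convergent_near_0_x: "convergent_near_0 formal_x"
  by (rule convergent_near_0_finite_support, rule finite_subset[of _ "{(1, 0)}"])
     (auto simp: formal_x_def fps_X_def split: if_splits)

lemma convergent_near_0_y: "convergent_near_0 formal_y"
  by (rule convergent_near_0_finite_support, rule finite_subset[of _ "{(0, 1)}"])
     (auto simp: formal_y_def fps_X_def split: if_splits)

lemma convergent_near_0_0: "convergent_near_0 0"
  by (rule convergent_near_0_finite_support) simp

lemma convergent_near_0_1: "convergent_near_0 1"
  using convergent_near_0_const[of 1] by (simp add: formal_const_def)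

lemma convergent_near_0_uminus: "convergent_near_0 h \<Longrightarrow> convergent_near_0 (- h)"
  by (simp add: convergent_near_0_iff_bound)

lemma convergent_near_0_add:
  assumes "convergent_near_0 g" "convergent_near_0 h"
  shows "convergent_near_0 (g + h)"
proof -
  obtain C R where g: "C > 0" "R \<ge> 1" "\<And>i j. norm (g $ j $ i) \<le> C * R ^ (i + j)"
    using assms(1) by (rule convergent_near_0E) blast
  obtain D S where h: "D > 0" "S \<ge> 1" "\<And>i j. norm (h $ j $ i) \<le> D * S ^ (i + j)"
    using assms(2) by (rule convergent_near_0E) blast
  show ?thesis
  proof (rule convergent_near_0I)
    fix i j
    have "norm ((g + h) $ j $ i) \<le> norm (g $ j $ i) + norm (h $ j $ i)"
      by (simp add: norm_triangle_ineq)
    also have "\<dots> \<le> C * (R * S) ^ (i + j) + D * (R * S) ^ (i + j)"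
    proof (rule add_mono)
      have "C * R ^ (i + j) \<le> C * (R * S) ^ (i + j)"
        using g h by (intro mult_left_mono power_mono) auto
      with g(3)[where i=i and j=j] show "norm (g $ j $ i) \<le> C * (R * S) ^ (i + j)" by linarith
      have "D * S ^ (i + j) \<le> D * (R * S) ^ (i + j)"
        using g h by (intro mult_left_mono power_mono) auto
      with h(3)[where i=i and j=j] show "norm (h $ j $ i) \<le> D * (R * S) ^ (i + j)" by linarith
    qed
    finally show "norm ((g + h) $ j $ i) \<le> (C + D) * (R * S) ^ (i + j)"
      by (simp add: algebra_simps)
  qed (use g h in auto)
qed

lemma convergent_near_0_diff:
  "convergent_near_0 g \<Longrightarrow> convergent_near_0 h \<Longrightarrow> convergent_near_0 (g - h)"
  using convergent_near_0_add[of g "- h"] convergent_near_0_uminus[of h] by simp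

lemma formal_mult_nth:
  "((g :: 'a :: comm_ring_1 fps fps) * h) $ j $ i
     = (\<Sum>b=0..j. \<Sum>a=0..i. g $ b $ a * h $ (j - b) $ (i - a))"
  by (simp add: fps_mult_nth fps_sum_nth)

lemma convergent_near_0_mult:
  assumes "convergent_near_0 g" "convergent_near_0 h"
  shows "convergent_near_0 (g * h)"
proof -
  obtain C R where g: "C > 0" "R \<ge> 1" "\<And>i j. norm (g $ j $ i) \<le> C * R ^ (i + j)"
    using assms(1) by (rule convergent_near_0E) blast
  obtain D S where h: "D > 0" "S \<ge> 1" "\<And>i j. norm (h $ j $ i) \<le> D * S ^ (i + j)"
    using assms(2) by (rule convergent_near_0E) blast
  show ?thesis
  proof (rule convergent_near_0I)
    fix i j :: nat
    let ?B = "C * D * (R * S) ^ (i + j)"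
    have B: "?B \<ge> 0" using g h by auto
    have bound: "norm (g $ b $ a * h $ (j - b) $ (i - a)) \<le> ?B" if "b \<le> j" "a \<le> i" for a b
    proof -
      have "norm (g $ b $ a * h $ (j - b) $ (i - a))
          \<le> (C * R ^ (a + b)) * (D * S ^ (i - a + (j - b)))"
        unfolding norm_mult using g h by (intro mult_mono) auto
      also have "\<dots> \<le> (C * R ^ (i + j)) * (D * S ^ (i + j))"
        using g h that by (intro mult_mono power_increasing mult_left_mono) auto
      finally show ?thesis by (simp add: power_mult_distrib mult_ac)
    qed
    have "norm ((g * h) $ j $ i) \<le> (\<Sum>b=0..j. \<Sum>a=0..i. ?B)"
      unfolding formal_mult_nth by (intro order_trans[OF norm_sum] sum_mono bound) auto
    also have "\<dots> = real ((j + 1) * (i + 1)) * ?B" by (simp add: algebra_simps)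
    also have "\<dots> \<le> real (2 ^ j * 2 ^ i) * ?B"
    proof (rule mult_right_mono)
      have "n + 1 \<le> 2 ^ n" for n :: nat by (induction n) auto
      then show "real ((j + 1) * (i + 1)) \<le> real (2 ^ j * 2 ^ i)"
        by (intro of_nat_mono mult_mono) auto
    qed (rule B)
    also have "\<dots> = C * D * (2 * R * S) ^ (i + j)"
      by (simp add: power_mult_distrib power_add mult_ac)
    finally show "norm ((g * h) $ j $ i) \<le> C * D * (2 * R * S) ^ (i + j)" .
  qed (use g h in auto)
qed

typedef conv_series = "{h. convergent_near_0 h}"
  morphisms to_formal Abs_conv_series
  using convergent_near_0_0 by auto

setup_lifting type_definition_conv_series

instantiation conv_series :: idom
begin

lift_definition zero_conv_series :: conv_series is 0
  by (rule convergent_near_0_0)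
lift_definition one_conv_series :: conv_series is 1
  by (rule convergent_near_0_1)
lift_definition plus_conv_series :: "conv_series \<Rightarrow> conv_series \<Rightarrow> conv_series" is "(+)"
  by (rule convergent_near_0_add)
lift_definition minus_conv_series :: "conv_series \<Rightarrow> conv_series \<Rightarrow> conv_series" is "(-)"
  by (rule convergent_near_0_diff)
lift_definition uminus_conv_series :: "conv_series \<Rightarrow> conv_series" is uminus
  by (rule convergent_near_0_uminus)
lift_definition times_conv_series :: "conv_series \<Rightarrow> conv_series \<Rightarrow> conv_series" is times
  by (rule convergent_near_0_mult)

instance by standard (transfer; simp add: algebra_simps)+

end

lift_definition conv_x :: conv_series is formal_x by (rule convergent_near_0_x)
lift_definition conv_y :: conv_series is formal_y by (rule convergent_near_0_y)
lift_definition conv_const :: "complex \<Rightarrow> conv_series" is formal_const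
  by (rule convergent_near_0_const)

definition ideal_gen :: "'a::comm_ring_1 set \<Rightarrow> 'a set" where
  "ideal_gen S = module.span times S"

lemma module_times: "module (times :: 'a::comm_ring_1 \<Rightarrow> 'a \<Rightarrow> 'a)"
  by unfold_locales (simp_all add: algebra_simps)

fun ideal_power :: "'a::comm_ring_1 set \<Rightarrow> nat \<Rightarrow> 'a set" where
  "ideal_power I 0 = UNIV"
| "ideal_power I (Suc n) = ideal_gen {a * b | a b. a \<in> I \<and> b \<in> ideal_power I n}"

definition max_ideal :: "conv_series set" where
  "max_ideal = ideal_gen {conv_x, conv_y}"

definition formal_max_ideal :: "formal_series set" where
  "formal_max_ideal = ideal_gen {formal_x, formal_y}"

text \<open>
  Here \<open>\<kappa>\<close> embeds the complex numbers in the ring as the constants, so the second clause is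
  linearity over the complex numbers.
\<close>

definition derivation :: "(complex \<Rightarrow> 'a::comm_ring_1) \<Rightarrow> ('a \<Rightarrow> 'a) \<Rightarrow> bool" where
  "derivation \<kappa> \<delta> \<longleftrightarrow>
     (\<forall>g h. \<delta> (g + h) = \<delta> g + \<delta> h) \<and>
     (\<forall>c h. \<delta> (\<kappa> c * h) = \<kappa> c * \<delta> h) \<and>
     (\<forall>g h. \<delta> (g * h) = g * \<delta> h + h * \<delta> g)"

definition Der :: "(conv_series \<Rightarrow> conv_series) set" where
  "Der = {\<delta>. derivation conv_const \<delta>}"

text \<open>
  The submodule \<open>I Der\<close> of \<open>Der\<close> generated by the products of an element of \<open>I\<close> and a derivation.
\<close>

definition ideal_Der :: "conv_series set \<Rightarrow> (conv_series \<Rightarrow> conv_series) set" where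
  "ideal_Der I = {\<lambda>h. \<Sum>k<n. a k * \<eta> k h | (n :: nat) a \<eta>. \<forall>k<n. a k \<in> I \<and> \<eta> k \<in> Der}"

abbreviation singular_Der :: "(conv_series \<Rightarrow> conv_series) set" where
  "singular_Der \<equiv> ideal_Der max_ideal"

definition log_Der :: "conv_series \<Rightarrow> (conv_series \<Rightarrow> conv_series) set" where
  "log_Der f = {\<delta> \<in> Der. \<delta> f \<in> ideal_gen {f}}"

definition is_product :: "conv_series \<Rightarrow> bool" where
  "is_product f \<longleftrightarrow> \<not> log_Der f \<subseteq> singular_Der"

definition formal_extension ::
    "(conv_series \<Rightarrow> conv_series) \<Rightarrow> formal_series \<Rightarrow> formal_series" where
  "formal_extension \<delta> =
     (THE D. derivation formal_const D \<and> (\<forall>h. D (to_formal h) = to_formal (\<delta> h)))"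

definition topologically_nilpotent :: "(conv_series \<Rightarrow> conv_series) \<Rightarrow> bool" where
  "topologically_nilpotent \<delta> \<longleftrightarrow>
     (\<forall>h k. \<forall>\<^sub>F m in sequentially.
        (formal_extension \<delta> ^^ m) h \<in> ideal_power formal_max_ideal k)"

text \<open>
  Every derivation of the convergent series has exactly one extension to the formal series, so the
  description operator above is meaningful.
\<close>

definition formal_dx :: "formal_series \<Rightarrow> formal_series" where
  "formal_dx h = Abs_fps (\<lambda>j. fps_deriv (h $ j))"

abbreviation formal_dy :: "formal_series \<Rightarrow> formal_series" where
  "formal_dy \<equiv> fps_deriv"

lemma derivation_formal_dx: "derivation formal_const formal_dx"
  unfolding derivation_def
proof (intro conjI allI)
  show "formal_dx (g * h) = g * formal_dx h + h * formal_dx g" for g h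
  proof (rule fps_ext)
    fix n
    have "formal_dx (g * h) $ n = (\<Sum>i=0..n. g $ i * fps_deriv (h $ (n - i)))
        + (\<Sum>i=0..n. fps_deriv (g $ i) * h $ (n - i))"
      by (simp add: formal_dx_def fps_mult_nth fps_deriv_sum sum.distrib)
    moreover have "(formal_dx g * h) $ n = (\<Sum>i=0..n. fps_deriv (g $ i) * h $ (n - i))"
      by (simp add: formal_dx_def fps_mult_nth)
    ultimately show "formal_dx (g * h) $ n = (g * formal_dx h + h * formal_dx g) $ n"
      by (simp add: formal_dx_def fps_mult_nth mult.commute[of h])
  qed
qed (auto simp: formal_dx_def formal_const_def fps_eq_iff)

lemma derivation_formal_dy: "derivation formal_const formal_dy"
  by (auto simp: derivation_def formal_const_def mult.commute)

lemma to_formal_simps [simp]: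
  "to_formal 0 = 0" "to_formal 1 = 1"
  "to_formal (g + h) = to_formal g + to_formal h"
  "to_formal (g - h) = to_formal g - to_formal h"
  "to_formal (- h) = - to_formal h"
  "to_formal (g * h) = to_formal g * to_formal h"
  "to_formal conv_x = formal_x" "to_formal conv_y = formal_y"
  "to_formal (conv_const c) = formal_const c"
  by (transfer; simp)+

lemma formal_decomposition:
  "h = formal_const (h $ 0 $ 0) + formal_x * fps_const (fps_shift 1 (h $ 0))
     + formal_y * fps_shift 1 h"
proof (rule fps_ext, rule fps_ext)
  fix j i
  show "h $ j $ i = (formal_const (h $ 0 $ 0) + formal_x * fps_const (fps_shift 1 (h $ 0))
     + formal_y * fps_shift 1 h) $ j $ i"
    by (cases j; cases i) (auto simp: formal_const_def formal_x_def formal_y_def)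
qed

lemma convergent_near_0_shift_x:
  assumes "convergent_near_0 h"
  shows "convergent_near_0 (fps_const (fps_shift 1 (h $ 0)))"
proof -
  obtain C R where h: "C > 0" "R \<ge> 1" "\<And>i j. norm (h $ j $ i) \<le> C * R ^ (i + j)"
    using assms by (rule convergent_near_0E) blast
  show ?thesis
    by (rule convergent_near_0I[where C = "C * R" and R = R])
       (use h h(3)[where j = 0 and i = "Suc _"] in \<open>auto simp: mult_ac\<close>)
qed

lemma convergent_near_0_shift_y:
  assumes "convergent_near_0 h"
  shows "convergent_near_0 (fps_shift 1 h)"
proof -
  obtain C R where h: "C > 0" "R \<ge> 1" "\<And>i j. norm (h $ j $ i) \<le> C * R ^ (i + j)"
    using assms by (rule convergent_near_0E) blast
  show ?thesis
    by (rule convergent_near_0I[where C = "C * R" and R = R])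
       (use h h(3)[where j = "Suc _"] in \<open>auto simp: mult_ac\<close>)
qed

lemma conv_decomposition:
  "\<exists>c g1 g2. h = conv_const c + conv_x * g1 + conv_y * g2"
proof (transfer, goal_cases)
  case (1 h)
  then show ?case
    using formal_decomposition[of h] convergent_near_0_shift_x[of h] convergent_near_0_shift_y[of h]
    by blast
qed

lemma derivation_const_eq_0:
  assumes "derivation \<kappa> D" "\<kappa> 1 = 1"
  shows "D (\<kappa> c) = 0"
proof -
  have "D (1 * 1) = 1 * D 1 + 1 * D 1" using assms(1) unfolding derivation_def by blast
  then have "D 1 = 0" by simp
  moreover have "D (\<kappa> c * 1) = \<kappa> c * D 1" using assms(1) unfolding derivation_def by blast
  ultimately show ?thesis by simp
qed

lemma twisted_derivation_eq_0:
  fixes \<iota> :: "'a::comm_ring_1 \<Rightarrow> formal_series"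
  assumes decomp: "\<And>h. \<exists>c g1 g2. h = \<kappa> c + u * g1 + v * g2"
    and add: "\<And>g h. E (g + h) = E g + E h"
    and mult: "\<And>g h. E (g * h) = \<iota> g * E h + \<iota> h * E g"
    and const: "\<And>c. E (\<kappa> c) = 0"
    and uv: "\<iota> u = formal_x" "\<iota> v = formal_y" "E u = 0" "E v = 0"
  shows "E h = 0"
proof -
  have "\<forall>i j. i + j < n \<longrightarrow> E h $ j $ i = 0" for n h
  proof (induction n arbitrary: h)
    case (Suc n)
    obtain c g1 g2 where h: "h = \<kappa> c + u * g1 + v * g2" using decomp by blast
    have E: "E h = formal_x * E g1 + formal_y * E g2"
      by (simp add: h add mult const uv)
    have x: "(formal_x * E g1) $ j $ i = (if i = 0 then 0 else E g1 $ j $ (i - 1))" for i j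
      by (simp add: formal_x_def)
    have y: "(formal_y * E g2) $ j $ i = (if j = 0 then 0 else E g2 $ (j - 1) $ i)" for i j
      by (simp add: formal_y_def)
    show ?case
      using Suc.IH[of g1] Suc.IH[of g2] by (auto simp: E x y)
  qed simp
  then show ?thesis by (metis fps_ext fps_zero_nth less_Suc_eq)
qed

lemma formal_extension_ex1:
  assumes "\<delta> \<in> Der"
  shows "\<exists>!D. derivation formal_const D \<and> (\<forall>h. D (to_formal h) = to_formal (\<delta> h))"
proof -
  have d: "derivation conv_const \<delta>" using assms by (simp add: Der_def)
  have one: "conv_const 1 = 1" "formal_const 1 = 1"
    by (transfer; simp add: formal_const_def) (simp add: formal_const_def)
  define D where "D = (\<lambda>h. to_formal (\<delta> conv_x) * formal_dx h + to_formal (\<delta> conv_y) * formal_dy h)"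
  have D: "derivation formal_const D"
    unfolding derivation_def
  proof (intro conjI allI)
    note dx = derivation_formal_dx[unfolded derivation_def]
    note dy = derivation_formal_dy[unfolded derivation_def]
    show "D (g + h) = D g + D h" for g h
      unfolding D_def dx[THEN conjunct1, rule_format] dy[THEN conjunct1, rule_format]
      by (simp add: algebra_simps)
    show "D (formal_const c * h) = formal_const c * D h" for c h
      unfolding D_def dx[THEN conjunct2, THEN conjunct1, rule_format]
        dy[THEN conjunct2, THEN conjunct1, rule_format]
      by (simp only: algebra_simps)
    show "D (g * h) = g * D h + h * D g" for g h
      unfolding D_def dx[THEN conjunct2, THEN conjunct2, rule_format]
        dy[THEN conjunct2, THEN conjunct2, rule_format]
      by (simp only: algebra_simps)
  qed
  have dxy: "formal_dx formal_x = 1" "formal_dy formal_x = 0"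
      "formal_dx formal_y = 0" "formal_dy formal_y = 1"
    by (auto simp: formal_dx_def formal_x_def formal_y_def fps_eq_iff fps_X_def)
  have "D (to_formal h) - to_formal (\<delta> h) = 0" for h
  proof (rule twisted_derivation_eq_0[where E = "\<lambda>h. D (to_formal h) - to_formal (\<delta> h)"
        and \<iota> = to_formal, OF conv_decomposition])
    show "D (to_formal (conv_const c)) - to_formal (\<delta> (conv_const c)) = 0" for c
      using derivation_const_eq_0[OF d] derivation_const_eq_0[OF D] one by simp
  qed (use d D in \<open>simp_all add: derivation_def algebra_simps\<close>,
       simp_all add: D_def dxy)
  then have ext: "\<forall>h. D (to_formal h) = to_formal (\<delta> h)" by simp
  show ?thesis
  proof (rule ex1I[of _ D])
    fix D' assume D': "derivation formal_const D' \<and> (\<forall>h. D' (to_formal h) = to_formal (\<delta> h))"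
    have "D' h - D h = 0" for h
    proof (rule twisted_derivation_eq_0[where E = "\<lambda>h. D' h - D h" and \<iota> = "\<lambda>h. h"
          and u = formal_x and v = formal_y and \<kappa> = formal_const])
      show "\<exists>c g1 g2. h = formal_const c + formal_x * g1 + formal_y * g2" for h
        using formal_decomposition by blast
      show "D' (formal_const c) - D (formal_const c) = 0" for c
        using derivation_const_eq_0[OF D one(2)] derivation_const_eq_0[OF conjunct1[OF D'] one(2)] by simp
      show "D' formal_x - D formal_x = 0" "D' formal_y - D formal_y = 0"
        using ext D' to_formal_simps(7,8) by (metis diff_self)+
    qed (use D D' in \<open>simp_all add: derivation_def algebra_simps\<close>)
    then show "D' = D" by auto
  qed (use D ext in blast)
qed

end

theory Submission
  imports Defs "HOL-Computational_Algebra.Fundamental_Theorem_Algebra"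
    "HOL-Computational_Algebra.Polynomial_FPS"
begin

text \<open>
  Write \<open>\<delta> = \<alpha> \<partial>\<^sub>x + \<beta> \<partial>\<^sub>y\<close>. If the linear part of \<open>\<delta>\<close> has square zero, then \<open>\<delta> ^ (k + 1)\<close> raises
  the order of series of order \<open>k\<close>, and \<open>\<delta>\<close> is topologically nilpotent. Otherwise let \<open>n \<ge> 3\<close> be the
  order of \<open>f\<close>. Since \<open>\<delta> f = g f\<close> with \<open>g\<close> in the maximal ideal, the linear part of \<open>\<delta>\<close> annihilates
  the leading form of \<open>f\<close>, so the simple linear factors of that form are eigendirections; there are
  at most two of these, and hence some linear factor is multiple, say \<open>x - c y\<close> with multiplicity
  \<open>a \<ge> 2\<close>. Blowing up this direction by \<open>x = y (t + c)\<close>, the equation for \<open>F = f / y ^ n\<close> becomes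
  \<open>A \<partial>\<^sub>t F + y \<partial>\<^sub>y F = G F\<close>, where \<open>G = - n\<close> and \<open>A = - (n / a) t + \<dots>\<close> on \<open>y = 0\<close>. There are no
  resonances below degree \<open>a\<close> in \<open>t\<close>, so \<open>\<partial>\<^sub>t F\<close> divides \<open>F\<close>, which forces \<open>F\<close> to be divisible by
  \<open>(t - \<sigma>(y))\<^sup>2\<close>. All divisions are Weierstrass divisions with convergent results, so
  \<open>(x - c y - y \<sigma>(y))\<^sup>2\<close> divides \<open>f\<close> in the ring of convergent series, which contradicts reducedness.
\<close>

subsection \<open>Division with convergent quotient and remainder\<close>

text \<open>Bounding all partial sums avoids summability questions. Unlike coefficientwise bounds
  \<open>C * R ^ i\<close>, these bounds multiply at a fixed radius \<open>\<rho>\<close>.\<close>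

definition l1_bounded :: "real \<Rightarrow> complex fps \<Rightarrow> real \<Rightarrow> bool" where
  "l1_bounded \<rho> u c \<longleftrightarrow> (\<forall>N. (\<Sum>i<N. norm (u $ i) * \<rho> ^ i) \<le> c)"

lemma l1_boundedD: "l1_bounded \<rho> u c \<Longrightarrow> (\<Sum>i<N. norm (u $ i) * \<rho> ^ i) \<le> c"
  by (simp add: l1_bounded_def)

lemma l1_bounded_0: "0 \<le> c \<Longrightarrow> l1_bounded \<rho> 0 c"
  by (simp add: l1_bounded_def)

lemma l1_bounded_nth:
  assumes "l1_bounded \<rho> u c" "\<rho> > 0"
  shows "norm (u $ i) * \<rho> ^ i \<le> c"
proof -
  have "norm (u $ i) * \<rho> ^ i \<le> (\<Sum>i<Suc i. norm (u $ i) * \<rho> ^ i)"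
    using assms(2) by (intro member_le_sum) auto
  then show ?thesis using l1_boundedD[OF assms(1)] order_trans by blast
qed

lemma l1_bounded_add:
  assumes "l1_bounded \<rho> u c" "l1_bounded \<rho> v d" "\<rho> > 0"
  shows "l1_bounded \<rho> (u + v) (c + d)"
  unfolding l1_bounded_def
proof
  fix N
  have "(\<Sum>i<N. norm ((u + v) $ i) * \<rho> ^ i)
      \<le> (\<Sum>i<N. norm (u $ i) * \<rho> ^ i) + (\<Sum>i<N. norm (v $ i) * \<rho> ^ i)"
    using assms(3) unfolding sum.distrib[symmetric] distrib_right[symmetric]
    by (intro sum_mono mult_right_mono) (auto intro: norm_triangle_ineq)
  then show "(\<Sum>i<N. norm ((u + v) $ i) * \<rho> ^ i) \<le> c + d"
    using l1_boundedD[OF assms(1), of N] l1_boundedD[OF assms(2), of N] by linarith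
qed

lemma l1_bounded_uminus: "l1_bounded \<rho> (- u) c \<longleftrightarrow> l1_bounded \<rho> u c"
  by (simp add: l1_bounded_def)

lemma l1_bounded_sum:
  assumes "\<And>a. a \<in> A \<Longrightarrow> l1_bounded \<rho> (u a) (c a)" "\<rho> > 0"
  shows "l1_bounded \<rho> (\<Sum>a\<in>A. u a) (\<Sum>a\<in>A. c a)"
  using assms by (induction A rule: infinite_finite_induct) (auto intro: l1_bounded_0 l1_bounded_add)

text \<open>The Cauchy product below degree \<open>N\<close> sums over the triangle
  \<open>a + b < N\<close>, which lies in the square \<open>a, b < N\<close>, where the double sum
  factors.\<close>

lemma l1_bounded_mult:
  assumes "l1_bounded \<rho> u c" "l1_bounded \<rho> v d" "\<rho> > 0"
  shows "l1_bounded \<rho> (u * v) (c * d)"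
  unfolding l1_bounded_def
proof
  fix N
  let ?g = "\<lambda>a b. (norm (u $ a) * \<rho> ^ a) * (norm (v $ b) * \<rho> ^ b)"
  have "norm ((u * v) $ k) * \<rho> ^ k \<le> (\<Sum>a\<le>k. ?g a (k - a))" for k
  proof -
    have "norm ((u * v) $ k) * \<rho> ^ k \<le> (\<Sum>a\<le>k. norm (u $ a * v $ (k - a))) * \<rho> ^ k"
      unfolding fps_mult_nth atLeast0AtMost using assms(3) by (intro mult_right_mono norm_sum) auto
    also have "\<dots> = (\<Sum>a\<le>k. ?g a (k - a))"
      unfolding sum_distrib_right
      by (intro sum.cong refl) (simp add: norm_mult mult_ac flip: power_add)
    finally show ?thesis .
  qed
  then have "(\<Sum>k<N. norm ((u * v) $ k) * \<rho> ^ k) \<le> (\<Sum>k<N. \<Sum>a\<le>k. ?g a (k - a))"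
    by (rule sum_mono)
  also have "\<dots> = (\<Sum>(a, b)\<in>{(a, b). a + b < N}. ?g a b)"
    by (rule sum.triangle_reindex[symmetric])
  also have "\<dots> \<le> (\<Sum>(a, b)\<in>{..<N} \<times> {..<N}. ?g a b)"
    using assms(3) by (intro sum_mono2) auto
  also have "\<dots> = (\<Sum>a<N. norm (u $ a) * \<rho> ^ a) * (\<Sum>b<N. norm (v $ b) * \<rho> ^ b)"
    by (simp add: sum_product sum.cartesian_product)
  also have "\<dots> \<le> c * d"
    using assms(3) order_trans[OF sum_nonneg l1_boundedD[OF assms(1), of N]]
    by (intro mult_mono l1_boundedD[OF assms(1)] l1_boundedD[OF assms(2)] sum_nonneg) auto
  finally show "(\<Sum>k<N. norm ((u * v) $ k) * \<rho> ^ k) \<le> c * d" .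
qed

lemma l1_bounded_shift:
  assumes "l1_bounded \<rho> u c" "\<rho> > 0"
  shows "l1_bounded \<rho> (fps_shift k u) (c / \<rho> ^ k)"
  unfolding l1_bounded_def
proof
  fix N
  have "(\<Sum>i<N. norm (fps_shift k u $ i) * \<rho> ^ i) * \<rho> ^ k
      = (\<Sum>i\<in>(\<lambda>i. i + k) ` {..<N}. norm (u $ i) * \<rho> ^ i)"
    by (subst sum.reindex) (simp_all add: sum_distrib_right power_add mult.assoc)
  also have "\<dots> \<le> (\<Sum>i<N + k. norm (u $ i) * \<rho> ^ i)"
    using assms(2) by (intro sum_mono2) auto
  also have "\<dots> \<le> c" by (rule l1_boundedD[OF assms(1)])
  finally show "(\<Sum>i<N. norm (fps_shift k u $ i) * \<rho> ^ i) \<le> c / \<rho> ^ k"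
    using assms(2) by (simp add: pos_le_divide_eq)
qed

lemma l1_bounded_geometric:
  assumes "\<And>i. norm (u $ i) \<le> C * R ^ i" "0 \<le> C" "\<rho> > 0" "R > 0" "\<rho> * R \<le> 1 / 2"
  shows "l1_bounded \<rho> u (2 * C)"
  unfolding l1_bounded_def
proof
  fix N
  have "(\<Sum>i<N. norm (u $ i) * \<rho> ^ i) \<le> (\<Sum>i<N. C * (1 / 2) ^ i)"
  proof (rule sum_mono)
    fix i
    have "norm (u $ i) * \<rho> ^ i \<le> C * R ^ i * \<rho> ^ i"
      using assms by (intro mult_right_mono) auto
    also have "\<dots> = C * (\<rho> * R) ^ i" by (simp add: power_mult_distrib)
    also have "\<dots> \<le> C * (1 / 2) ^ i" using assms by (intro mult_left_mono power_mono) auto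
    finally show "norm (u $ i) * \<rho> ^ i \<le> C * (1 / 2) ^ i" .
  qed
  also have "\<dots> = C * (2 - 2 * (1 / 2) ^ N)"
    by (subst sum_distrib_left[symmetric], subst sum_gp_strict) (simp add: field_simps)
  also have "\<dots> \<le> 2 * C" using assms(2) by (simp add: algebra_simps)
  finally show "(\<Sum>i<N. norm (u $ i) * \<rho> ^ i) \<le> 2 * C" .
qed

section \<open>Geometric majorants for inversion and division\<close>

text \<open>Closed form of the majorant recursion common to inversion and Weierstrass division: a
  geometric term plus a convolution with the earlier bounds. After cancellation the sum over
  \<open>b\<close> is geometric with ratio \<open>1 + K\<close>.\<close>

lemma geometric_recursion:
  fixes K S :: real
  shows "K * S ^ j + (\<Sum>b<j. (K * ((1 + K) * S) ^ b) * (K * S ^ (j - b))) = K * ((1 + K) * S) ^ j"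
proof -
  have "(\<Sum>b<j. (K * ((1 + K) * S) ^ b) * (K * S ^ (j - b))) = (\<Sum>b<j. K * S ^ j * (K * (1 + K) ^ b))"
  proof (rule sum.cong)
    fix b assume "b \<in> {..<j}"
    then have "S ^ j = S ^ b * S ^ (j - b)" by (simp flip: power_add)
    then show "(K * ((1 + K) * S) ^ b) * (K * S ^ (j - b)) = K * S ^ j * (K * (1 + K) ^ b)"
      by (simp add: power_mult_distrib mult_ac)
  qed simp
  also have "\<dots> = K * S ^ j * ((1 + K) ^ j - 1)"
    using power_diff_1_eq[of "1 + K" j] by (simp flip: sum_distrib_left)
  finally show ?thesis unfolding power_mult_distrib by (simp add: algebra_simps)
qed

text \<open>The coefficient of degree \<open>i\<close> in \<open>inverse u * u = 1\<close> expresses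
  \<open>inverse u $ i\<close> by its predecessors; divided by \<open>u $ 0\<close>, this is the
  recursion solved in \<open>geometric_recursion\<close>.\<close>

lemma inverse_fps_geometric:
  fixes u :: "complex fps"
  assumes u: "\<And>i. norm (u $ i) \<le> C * R ^ i" and C: "C > 0" "R > 0" and u0: "u $ 0 \<noteq> 0"
  obtains C' R' where "C' > 0" "R' > 0" "\<And>i. norm (inverse u $ i) \<le> C' * R' ^ i"
proof
  \<comment> \<open>The numerator is \<open>C + 1\<close> because it must also dominate the
    coefficient 1 of the unit series in degree 0.\<close>
  define K where "K = (C + 1) / norm (u $ 0)"
  show K: "K > 0" "(1 + K) * R > 0" using C u0 by (auto simp: K_def intro!: divide_pos_pos mult_pos_pos add_pos_pos)
  have KN: "K * norm (u $ 0) = C + 1" using u0 by (simp add: K_def)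
  let ?v = "inverse u"
  show "norm (?v $ i) \<le> K * ((1 + K) * R) ^ i" for i
  proof (induction i rule: less_induct)
    case (less i)
    have "(?v * u) $ i = (\<Sum>b<i. ?v $ b * u $ (i - b)) + ?v $ i * u $ 0"
      unfolding fps_mult_nth atLeast0AtMost by (cases i) (simp_all add: lessThan_Suc_atMost)
    then have "?v $ i * u $ 0 = (if i = 0 then 1 else 0) - (\<Sum>b<i. ?v $ b * u $ (i - b))"
      using inverse_mult_eq_1[OF u0] by auto
    then have "norm (?v $ i) * norm (u $ 0) \<le> norm (if i = 0 then 1 else 0 :: complex) + norm (\<Sum>b<i. ?v $ b * u $ (i - b))"
      unfolding norm_mult[symmetric] by (simp only: norm_triangle_ineq4)
    also have "\<dots> \<le> (C + 1) * R ^ i + (\<Sum>b<i. (K * ((1 + K) * R) ^ b) * ((C + 1) * R ^ (i - b)))"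
    proof (intro add_mono order_trans[OF norm_sum] sum_mono)
      show "norm (if i = 0 then 1 else 0 :: complex) \<le> (C + 1) * R ^ i" using C by auto
      fix b assume "b \<in> {..<i}"
      then show "norm (?v $ b * u $ (i - b)) \<le> (K * ((1 + K) * R) ^ b) * ((C + 1) * R ^ (i - b))"
        unfolding norm_mult using less K C
        by (intro mult_mono order_trans[OF u] mult_right_mono) auto
    qed
    also have "\<dots> = (K * R ^ i + (\<Sum>b<i. (K * ((1 + K) * R) ^ b) * (K * R ^ (i - b)))) * norm (u $ 0)"
      unfolding KN[symmetric] by (simp add: distrib_left sum_distrib_left mult_ac)
    finally show ?case using u0 unfolding geometric_recursion by simp
  qed
qed

text \<open>Coefficients in y of the Weierstrass quotient. Since \<open>D $ 0\<close> is a power of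
  x times a unit, the shift drops the terms that go to the remainder and the inverse divides by the
  unit.\<close>

fun quotient_coeff :: "formal_series \<Rightarrow> formal_series \<Rightarrow> nat \<Rightarrow> complex fps" where
  "quotient_coeff D G j = inverse (fps_shift (subdegree (D $ 0)) (D $ 0)) *
     fps_shift (subdegree (D $ 0)) (G $ j - (\<Sum>b<j. quotient_coeff D G b * D $ (j - b)))"

declare quotient_coeff.simps [simp del]

text \<open>
  The Weierstrass division theorem; the division of the coefficients of \<open>y ^ j\<close> loses only a
  constant factor in the norm, so the coefficients of the quotient grow geometrically.
\<close>

lemma convergent_division:
  assumes D: "convergent_near_0 D" and G: "convergent_near_0 G" and D0: "D $ 0 \<noteq> 0"
  obtains Q R where "convergent_near_0 Q" "convergent_near_0 R" "G = Q * D + R"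
    "\<And>j i. subdegree (D $ 0) \<le> i \<Longrightarrow> R $ j $ i = 0"
proof -
  define k where "k = subdegree (D $ 0)"
  define U where "U = fps_shift k (D $ 0)"
  define T where "T j = G $ j - (\<Sum>b<j. quotient_coeff D G b * D $ (j - b))" for j
  define Q where "Q = Abs_fps (quotient_coeff D G)"
  define R where "R = Abs_fps (\<lambda>j. fps_cutoff k (T j))"
  have Q: "Q $ j = inverse U * fps_shift k (T j)" for j
    by (simp add: Q_def quotient_coeff.simps[of D G j] U_def k_def T_def)
  have D0_eq: "D $ 0 = U * fps_X ^ k"
    unfolding U_def k_def by (rule subdegree_decompose)
  have U0: "U $ 0 \<noteq> 0" using D0 by (simp add: U_def k_def)
  have GQR: "G = Q * D + R"
  proof (rule fps_ext)
    fix j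
    have "Q $ j * D $ 0 = (inverse U * U) * (fps_shift k (T j) * fps_X ^ k)"
      by (simp only: Q D0_eq mult_ac)
    also have "\<dots> = T j - R $ j"
      unfolding inverse_mult_eq_1[OF U0] using fps_shift_cutoff[of k "T j"]
      by (simp add: R_def eq_diff_eq)
    finally have "Q $ j * D $ 0 = T j - R $ j" .
    moreover have "(Q * D) $ j = (\<Sum>b<j. Q $ b * D $ (j - b)) + Q $ j * D $ 0"
      unfolding fps_mult_nth atLeast0AtMost by (cases j) (simp_all add: lessThan_Suc_atMost)
    ultimately show "G $ j = (Q * D + R) $ j" by (simp add: T_def Q_def)
  qed
  obtain C1 R1 where 1: "C1 > 0" "R1 \<ge> 1" "\<And>i j. norm (D $ j $ i) \<le> C1 * R1 ^ (i + j)"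
    using D by (rule convergent_near_0E) blast
  obtain C2 R2 where 2: "C2 > 0" "R2 \<ge> 1" "\<And>i j. norm (G $ j $ i) \<le> C2 * R2 ^ (i + j)"
    using G by (rule convergent_near_0E) blast
  define C S where "C = C1 + C2" and "S = R1 + R2"
  have CS: "C > 0" "S > 0" using 1 2 by (auto simp: C_def S_def)
  have Db: "norm (D $ j $ i) \<le> (C * S ^ j) * S ^ i" for i j
  proof -
    have "C1 * R1 ^ (i + j) \<le> C * S ^ (i + j)"
      using 1 2 by (intro mult_mono power_mono) (auto simp: C_def S_def)
    with 1(3)[of j i] show ?thesis by (simp add: power_add mult_ac)
  qed
  have Gb: "norm (G $ j $ i) \<le> (C * S ^ j) * S ^ i" for i j
  proof -
    have "C2 * R2 ^ (i + j) \<le> C * S ^ (i + j)"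
      using 1 2 by (intro mult_mono power_mono) (auto simp: C_def S_def)
    with 2(3)[of j i] show ?thesis by (simp add: power_add mult_ac)
  qed
  have "norm (U $ i) \<le> (C * S ^ k) * S ^ i" for i
    using Db[of 0 "i + k"] by (simp add: U_def power_add mult_ac)
  then obtain C' R' where inv: "C' > 0" "R' > 0" "\<And>i. norm (inverse U $ i) \<le> C' * R' ^ i"
    using inverse_fps_geometric[of U "C * S ^ k" S] CS U0 by (metis mult_pos_pos zero_less_power)
  \<comment> \<open>At this radius the geometric majorants of \<open>D\<close>, \<open>G\<close> and
    \<open>inverse U\<close> all have ratio at most 1 / 2.\<close>
  define \<rho> where "\<rho> = 1 / (2 * (S + R'))"
  have \<rho>: "\<rho> > 0" "\<rho> * S \<le> 1 / 2" "\<rho> * R' \<le> 1 / 2"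
    using CS inv by (auto simp: \<rho>_def field_simps)
  have lD: "l1_bounded \<rho> (D $ j) (2 * C * S ^ j)" and lG: "l1_bounded \<rho> (G $ j) (2 * C * S ^ j)" for j
    using l1_bounded_geometric[OF Db[of j], of \<rho>] l1_bounded_geometric[OF Gb[of j], of \<rho>] CS \<rho>
    by (simp_all add: mult.assoc)
  have lU: "l1_bounded \<rho> (inverse U) (2 * C')"
    using l1_bounded_geometric[OF inv(3), of \<rho>] inv \<rho> by simp
  \<comment> \<open>The factor \<open>2 * C' / \<rho> ^ k\<close> bounds the division by
    \<open>D $ 0\<close>, and \<open>2 * C\<close> bounds the coefficients of \<open>D\<close> and
    \<open>G\<close>.\<close>
  define K where "K = 2 * C' * (2 * C / \<rho> ^ k)"
  have K: "K > 0" using inv CS \<rho> by (simp add: K_def)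
  define M where "M = (1 + K) * S"
  have M: "M > 0" using K CS by (simp add: M_def)
  have lQ: "l1_bounded \<rho> (Q $ j) (K * M ^ j)" for j
  proof (induction j rule: less_induct)
    case (less j)
    have "l1_bounded \<rho> (G $ j + - (\<Sum>b<j. Q $ b * D $ (j - b)))
        (2 * C * S ^ j + (\<Sum>b<j. (K * M ^ b) * (2 * C * S ^ (j - b))))"
      by (intro l1_bounded_add l1_bounded_uminus[THEN iffD2] l1_bounded_sum l1_bounded_mult lG lD less \<rho>) auto
    then have "l1_bounded \<rho> (T j) (2 * C * S ^ j + (\<Sum>b<j. (K * M ^ b) * (2 * C * S ^ (j - b))))"
      by (simp add: T_def Q_def)
    then have "l1_bounded \<rho> (Q $ j)
        (2 * C' * ((2 * C * S ^ j + (\<Sum>b<j. (K * M ^ b) * (2 * C * S ^ (j - b)))) / \<rho> ^ k))"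
      unfolding Q by (intro l1_bounded_mult l1_bounded_shift lU \<rho>)
    moreover have "2 * C' * ((2 * C * S ^ j + (\<Sum>b<j. (K * M ^ b) * (2 * C * S ^ (j - b)))) / \<rho> ^ k)
        = K * S ^ j + (\<Sum>b<j. (K * M ^ b) * (K * S ^ (j - b)))"
    proof -
      define e where "e = 2 * C' / \<rho> ^ k"
      have e: "2 * C * (e * x) = K * x" for x by (simp add: e_def K_def)
      have "2 * C' * (x / \<rho> ^ k) = e * x" for x by (simp add: e_def)
      then show ?thesis
        by (simp only: distrib_left sum_distrib_left mult.left_commute[of e] e)
    qed
    ultimately show ?case unfolding M_def geometric_recursion by simp
  qed
  have "convergent_near_0 Q"
  proof (rule convergent_near_0I)
    fix i j
    have "norm (Q $ j $ i) \<le> K * M ^ j * (1 / \<rho>) ^ i"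
      using l1_bounded_nth[OF lQ \<rho>(1), of j i] \<rho>(1) by (simp add: field_simps)
    also have "\<dots> \<le> K * (M + 1 / \<rho>) ^ j * (M + 1 / \<rho>) ^ i"
      using K M \<rho>(1) by (intro mult_mono power_mono) auto
    finally show "norm (Q $ j $ i) \<le> K * (M + 1 / \<rho>) ^ (i + j)" by (simp add: power_add mult_ac)
  qed (use K M \<rho> in \<open>auto intro!: add_pos_pos\<close>)
  moreover have "convergent_near_0 R"
    using convergent_near_0_diff[OF G convergent_near_0_mult[OF \<open>convergent_near_0 Q\<close> D]] GQR
    by (simp add: algebra_simps)
  moreover have "R $ j $ i = 0" if "subdegree (D $ 0) \<le> i" for j i
    using that by (simp add: R_def k_def)
  ultimately show ?thesis using that GQR by blast
qed

text \<open>The coefficients of \<open>K\<close> below \<open>m\<close> vanish one after the other,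
  so the lowest coefficient of the multiple is itself a multiple of \<open>D $ 0\<close>. This is
  the uniqueness side of the division and is used to show that remainders vanish.\<close>

lemma multiple_lowest_coeff:
  fixes D K :: formal_series
  assumes low: "\<And>j. j < m \<Longrightarrow> (K * D) $ j = 0" and D0: "D $ 0 \<noteq> 0" and i: "i < subdegree (D $ 0)"
  shows "(K * D) $ m $ i = 0"
proof -
  have split: "(K * D) $ j = (\<Sum>b<j. K $ b * D $ (j - b)) + K $ j * D $ 0" for j
    unfolding fps_mult_nth atLeast0AtMost by (cases j) (simp_all add: lessThan_Suc_atMost)
  have K: "K $ j = 0" if "j < m" for j
    using that
  proof (induction j rule: less_induct)
    case (less j)
    then have "K $ j * D $ 0 = 0" using split[of j] low[of j] by simp
    then show ?case using D0 by simp
  qed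
  then have "(K * D) $ m = K $ m * D $ 0" using split[of m] by simp
  moreover have "(K $ m * D $ 0) $ i = 0" unfolding fps_mult_nth
    using i by (intro sum.neutral) (auto intro!: nth_less_subdegree_zero)
  ultimately show ?thesis by simp
qed

subsection \<open>Blowing up a point\<close>

lemma formal_dx_nth: "formal_dx h $ j = fps_deriv (h $ j)"
  by (simp add: formal_dx_def)

lemma formal_dx_simps [simp]:
  "formal_dx (g + h) = formal_dx g + formal_dx h"
  "formal_dx (g - h) = formal_dx g - formal_dx h"
  "formal_dx (g * h) = g * formal_dx h + h * formal_dx g"
  "formal_dx formal_x = 1" "formal_dx formal_y = 0" "formal_dx (formal_const c) = 0"
proof -
  show "formal_dx (g * h) = g * formal_dx h + h * formal_dx g"
    using derivation_formal_dx unfolding derivation_def by blast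
qed (auto simp: formal_dx_def formal_x_def formal_y_def formal_const_def fps_eq_iff fps_X_def)

lemma formal_dy_simps [simp]:
  "formal_dy formal_x = 0" "formal_dy formal_y = 1" "formal_dy (formal_const c) = 0"
  by (auto simp: formal_x_def formal_y_def formal_const_def fps_eq_iff fps_X_def)

lemma formal_dx_dy: "formal_dx (formal_dy h) = formal_dy (formal_dx h)"
  by (simp add: fps_eq_iff formal_dx_nth algebra_simps)

lemma formal_dx_power_y [simp]: "formal_dx (formal_y ^ n * h) = formal_y ^ n * formal_dx h"
  by (induction n arbitrary: h) (simp_all add: mult.assoc)

lemma formal_y_dy_power_y:
  "formal_y * formal_dy (formal_y ^ n * h) = formal_y ^ n * (of_nat n * h + formal_y * formal_dy h)"
proof (induction n arbitrary: h)
  case (Suc n)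
  have "formal_y ^ Suc n * h = formal_y ^ n * (formal_y * h)" by (simp add: mult_ac)
  then show ?case using Suc.IH[of "formal_y * h"] by (simp add: algebra_simps)
qed simp

lemma formal_y_mult_nth: "(formal_y * h) $ j = (if j = 0 then 0 else h $ (j - 1))"
  by (simp add: formal_y_def)

lemma formal_y_power_mult_nth: "(formal_y ^ n * h) $ j = (if j < n then 0 else h $ (j - n))"
  by (simp add: formal_y_def fps_X_power_mult_nth)

lemma formal_x_mult_nth: "(formal_x * h) $ j = fps_X * h $ j"
  by (simp add: formal_x_def)

section \<open>The chart substitution and its chain rule\<close>

text \<open>This is \<open>h (y * (x + c), y)\<close>, the chart coordinate being again called x. A
  monomial \<open>x ^ i * y ^ j\<close> goes to \<open>y ^ (i + j) * (x + c) ^ i\<close>, so the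
  homogeneous part of degree \<open>d\<close> alone yields the coefficient of
  \<open>y ^ d\<close>.\<close>

definition blowup :: "complex \<Rightarrow> formal_series \<Rightarrow> formal_series" where
  "blowup c h = Abs_fps (\<lambda>d. \<Sum>i\<le>d. fps_const (h $ (d - i) $ i) * (fps_X + fps_const c) ^ i)"

lemma blowup_nth:
  "blowup c h $ d = (\<Sum>i\<le>d. fps_const (h $ (d - i) $ i) * (fps_X + fps_const c) ^ i)"
  by (simp add: blowup_def)

lemma blowup_add: "blowup c (g + h) = blowup c g + blowup c h"
  by (simp add: fps_eq_iff[of "blowup c (g + h)"] blowup_nth sum.distrib distrib_right
      flip: fps_const_add)

lemma blowup_const_mult: "blowup c (formal_const k * h) = formal_const k * blowup c h"
  by (rule fps_ext) (simp add: blowup_nth sum_distrib_left formal_const_def mult.assoc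
      flip: fps_const_mult)

lemma blowup_diff: "blowup c (g - h) = blowup c g - blowup c h"
  using blowup_add[of c "g - h" h] by simp

lemma blowup_x_mult:
  "blowup c (formal_x * h) = formal_y * ((formal_x + formal_const c) * blowup c h)"
proof (rule fps_ext)
  fix d
  show "blowup c (formal_x * h) $ d = (formal_y * ((formal_x + formal_const c) * blowup c h)) $ d"
  proof (cases d)
    case 0
    then show ?thesis by (simp add: blowup_nth formal_x_def formal_y_def)
  next
    case (Suc e)
    have "blowup c (formal_x * h) $ d
        = (\<Sum>i\<le>e. fps_const (h $ (e - i) $ i) * (fps_X + fps_const c) ^ Suc i)"
      unfolding blowup_nth Suc sum.atMost_Suc_shift by (simp add: formal_x_mult_nth)
    also have "\<dots> = (fps_X + fps_const c) * blowup c h $ e"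
      by (simp add: blowup_nth sum_distrib_left mult_ac)
    also have "\<dots> = (formal_y * ((formal_x + formal_const c) * blowup c h)) $ d"
      unfolding formal_y_mult_nth
      by (simp add: Suc distrib_right formal_x_mult_nth formal_const_def)
    finally show ?thesis .
  qed
qed

lemma blowup_y_mult: "blowup c (formal_y * h) = formal_y * blowup c h"
proof (rule fps_ext)
  fix d
  show "blowup c (formal_y * h) $ d = (formal_y * blowup c h) $ d"
  proof (cases d)
    case (Suc e)
    have "(\<Sum>i\<le>e. fps_const ((formal_y * h) $ (Suc e - i) $ i) * (fps_X + fps_const c) ^ i)
        = (\<Sum>i\<le>e. fps_const (h $ (e - i) $ i) * (fps_X + fps_const c) ^ i)"
      by (intro sum.cong refl) (simp add: formal_y_mult_nth Suc_diff_le)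
    then show ?thesis
      by (simp add: Suc blowup_nth formal_y_mult_nth)
  qed (simp add: blowup_nth formal_y_def)
qed

lemma blowup_const: "blowup c (formal_const k) = formal_const k"
proof (rule fps_ext)
  fix d
  show "blowup c (formal_const k) $ d = formal_const k $ d"
    unfolding blowup_nth by (cases d) (auto simp: formal_const_def intro!: sum.neutral)
qed

text \<open>Iterating the hypothesis puts \<open>E h\<close> into every power of y. Identities for
  the substitution thus need checking only on constants and under multiplication by x and y, with no
  continuity argument.\<close>

lemma zero_by_decomposition:
  fixes E :: "formal_series \<Rightarrow> formal_series"
  assumes "\<And>k g1 g2. \<exists>u v. E (formal_const k + formal_x * g1 + formal_y * g2) = formal_y * (u * E g1 + v * E g2)"
  shows "E h = 0"
proof -
  have "\<forall>j<n. E h $ j = 0" for n h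
  proof (induction n arbitrary: h)
    case (Suc n)
    obtain k g1 g2 where h: "h = formal_const k + formal_x * g1 + formal_y * g2"
      using formal_decomposition by blast
    obtain u v where E: "E h = formal_y * (u * E g1 + v * E g2)"
      using assms[of k g1 g2] unfolding h by blast
    have "(u * E g1 + v * E g2) $ j = 0" if "j < n" for j
      using Suc.IH[of g1] Suc.IH[of g2] that by (simp add: fps_mult_nth)
    then show ?case unfolding E formal_y_mult_nth by auto
  qed simp
  then show ?thesis by (metis fps_ext fps_zero_nth lessI)
qed

lemma blowup_mult: "blowup c (g * h) = blowup c g * blowup c h"
proof -
  let ?E = "\<lambda>g. blowup c (g * h) - blowup c g * blowup c h"
  have "?E g = 0"
  proof (rule zero_by_decomposition[where E = ?E])
    fix k g1 g2
    have "blowup c ((formal_const k + formal_x * g1 + formal_y * g2) * h) = formal_const k * blowup c h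
        + formal_y * ((formal_x + formal_const c) * blowup c (g1 * h)) + formal_y * blowup c (g2 * h)"
      by (simp only: distrib_right mult.assoc blowup_add blowup_const_mult blowup_x_mult blowup_y_mult)
    then have "?E (formal_const k + formal_x * g1 + formal_y * g2)
       = formal_y * ((formal_x + formal_const c) * ?E g1 + 1 * ?E g2)"
      by (simp add: blowup_add blowup_x_mult blowup_y_mult blowup_const algebra_simps)
    then show "\<exists>u v. ?E (formal_const k + formal_x * g1 + formal_y * g2)
       = formal_y * (u * ?E g1 + v * ?E g2)" by blast
  qed
  then show ?thesis by simp
qed

lemma formal_dx_blowup: "formal_dx (blowup c h) = formal_y * blowup c (formal_dx h)"
proof -
  let ?E = "\<lambda>h. formal_dx (blowup c h) - formal_y * blowup c (formal_dx h)"
  have "?E h = 0"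
  proof (rule zero_by_decomposition[where E = ?E])
    fix k g1 g2
    have "?E (formal_const k + formal_x * g1 + formal_y * g2)
       = formal_y * ((formal_x + formal_const c) * ?E g1 + 1 * ?E g2)"
      by (simp add: blowup_add blowup_const_mult blowup_x_mult blowup_y_mult blowup_const algebra_simps)
    then show "\<exists>u v. ?E (formal_const k + formal_x * g1 + formal_y * g2)
       = formal_y * (u * ?E g1 + v * ?E g2)" by blast
  qed
  then show ?thesis by simp
qed

text \<open>The chain rule for \<open>x = y * (t + c)\<close>, multiplied by y since the blown-up
  equation is written with the operator \<open>y * formal_dy\<close>.\<close>

lemma formal_dy_blowup:
  "formal_y * formal_dy (blowup c h)
     = formal_y * ((formal_x + formal_const c) * blowup c (formal_dx h) + blowup c (formal_dy h))"
proof -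
  let ?E = "\<lambda>h. formal_y * formal_dy (blowup c h)
     - formal_y * ((formal_x + formal_const c) * blowup c (formal_dx h) + blowup c (formal_dy h))"
  have "?E h = 0"
  proof (rule zero_by_decomposition[where E = ?E])
    fix k g1 g2
    have "?E (formal_const k + formal_x * g1 + formal_y * g2)
       = formal_y * ((formal_x + formal_const c) * ?E g1 + 1 * ?E g2)"
      by (simp add: blowup_add blowup_const_mult blowup_x_mult blowup_y_mult blowup_const algebra_simps)
    then show "\<exists>u v. ?E (formal_const k + formal_x * g1 + formal_y * g2)
       = formal_y * (u * ?E g1 + v * ?E g2)" by blast
  qed
  then show ?thesis by simp
qed

lemma blowup_eq_self:
  assumes "\<And>j i. 0 < i \<Longrightarrow> h $ j $ i = 0"
  shows "blowup c h = h"
proof (rule fps_ext)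
  fix d
  have "blowup c h $ d = (\<Sum>i\<in>{0}. fps_const (h $ (d - i) $ i) * (fps_X + fps_const c) ^ i)"
    unfolding blowup_nth by (rule sum.mono_neutral_right) (use assms in auto)
  also have "\<dots> = h $ d"
    by (rule fps_ext) (use assms[of _ d] in auto)
  finally show "blowup c h $ d = h $ d" .
qed

text \<open>Coefficientwise description of the \<open>k\<close>-th power of the maximal
  ideal.\<close>

definition vanishes_below :: "nat \<Rightarrow> formal_series \<Rightarrow> bool" where
  "vanishes_below k h \<longleftrightarrow> (\<forall>i j. i + j < k \<longrightarrow> h $ j $ i = 0)"

lemma blowup_shift:
  assumes "vanishes_below n h"
  shows "blowup c h = formal_y ^ n * fps_shift n (blowup c h)"
proof (rule fps_ext)
  fix d
  have "blowup c h $ d = 0" if "d < n"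
    unfolding blowup_nth using assms that by (intro sum.neutral) (auto simp: vanishes_below_def)
  then show "blowup c h $ d = (formal_y ^ n * fps_shift n (blowup c h)) $ d"
    by (simp add: formal_y_power_mult_nth)
qed

text \<open>At radius 1 the linear series has norm at most \<open>1 + norm c\<close>, and the norm
  is submultiplicative.\<close>

lemma linear_fps_power_nth_le: "norm (((fps_X + fps_const c) ^ l :: complex fps) $ i) \<le> (1 + norm c) ^ l"
proof -
  have lin: "l1_bounded 1 (fps_X + fps_const c) (1 + norm c)"
    unfolding l1_bounded_def
  proof
    fix N
    have "(\<Sum>i<N. norm ((fps_X + fps_const c) $ i) * 1 ^ i)
        \<le> (\<Sum>i<N + 2. norm ((fps_X + fps_const c) $ i))"
      unfolding power_one mult_1_right by (intro sum_mono2) auto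
    also have "\<dots> = (\<Sum>i<2. norm ((fps_X + fps_const c) $ i))"
      by (rule sum.mono_neutral_right) auto
    finally show "(\<Sum>i<N. norm ((fps_X + fps_const c) $ i) * 1 ^ i) \<le> 1 + norm c"
      by (simp add: numeral_2_eq_2)
  qed
  have "l1_bounded 1 ((fps_X + fps_const c) ^ l) ((1 + norm c) ^ l)"
  proof (induction l)
    case 0
    have "(\<Sum>i<N. norm ((1 :: complex fps) $ i) * 1 ^ i) \<le> 1" for N
      by (cases N) (simp_all add: sum.lessThan_Suc_shift del: sum.lessThan_Suc)
    then show ?case by (simp add: l1_bounded_def)
  next
    case (Suc l)
    show ?case unfolding power_Suc by (intro l1_bounded_mult lin Suc) simp
  qed
  from l1_bounded_nth[OF this, of i] show ?thesis by simp
qed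

lemma convergent_blowup:
  assumes "convergent_near_0 h"
  shows "convergent_near_0 (blowup c h)"
proof -
  obtain C R where h: "C > 0" "R \<ge> 1" "\<And>i j. norm (h $ j $ i) \<le> C * R ^ (i + j)"
    using assms by (rule convergent_near_0E) blast
  \<comment> \<open>The factor 2 absorbs the number \<open>d + 1\<close> of summands of the
    coefficient of \<open>y ^ d\<close>.\<close>
  define M where "M = 2 * R * (1 + norm c)"
  have R1: "R * 1 \<le> R * (1 + norm c)" using h by (intro mult_left_mono) auto
  have M: "M \<ge> 1" unfolding M_def using R1 h by linarith
  show ?thesis
  proof (rule convergent_near_0I)
    fix i d
    have "norm (blowup c h $ d $ i) \<le> (\<Sum>l\<le>d. C * R ^ d * (1 + norm c) ^ d)"
      unfolding blowup_nth fps_sum_nth fps_mult_left_const_nth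
    proof (intro order_trans[OF norm_sum] sum_mono)
      fix l assume l: "l \<in> {..d}"
      have "(1 + norm c) ^ l \<le> (1 + norm c) ^ d" using l by (intro power_increasing) auto
      then show "norm (h $ (d - l) $ l * ((fps_X + fps_const c) ^ l) $ i) \<le> C * R ^ d * (1 + norm c) ^ d"
        unfolding norm_mult using l h(3)[of "d - l" l] h(1,2)
        by (intro mult_mono order_trans[OF linear_fps_power_nth_le]) auto
    qed
    also have "\<dots> = real (d + 1) * (C * R ^ d * (1 + norm c) ^ d)" by simp
    also have "\<dots> \<le> 2 ^ d * (C * R ^ d * (1 + norm c) ^ d)"
    proof (rule mult_right_mono)
      have "d + 1 \<le> 2 ^ d" by (induction d) auto
      then have "real (d + 1) \<le> real (2 ^ d)" by (rule of_nat_mono)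
      then show "real (d + 1) \<le> 2 ^ d" by simp
    qed (use h in auto)
    also have "\<dots> = C * M ^ d" by (simp add: M_def power_mult_distrib)
    also have "\<dots> \<le> C * M ^ (i + d)" using M h by (intro mult_left_mono power_increasing) auto
    finally show "norm (blowup c h $ d $ i) \<le> C * M ^ (i + d)" .
  qed (use M h in auto)
qed

lemma convergent_fps_shift: "convergent_near_0 h \<Longrightarrow> convergent_near_0 (fps_shift n h)"
proof (induction n arbitrary: h)
  case (Suc n)
  have "fps_shift (Suc n) h = fps_shift n (fps_shift 1 h)" by (simp add: fps_eq_iff)
  then show ?case using Suc convergent_near_0_shift_y by simp
qed simp

lemma convergent_formal_dx:
  assumes "convergent_near_0 h"
  shows "convergent_near_0 (formal_dx h)"
proof -
  obtain C R where h: "C > 0" "R \<ge> 1" "\<And>i j. norm (h $ j $ i) \<le> C * R ^ (i + j)"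
    using assms by (rule convergent_near_0E) blast
  show ?thesis
  proof (rule convergent_near_0I)
    fix i j :: nat
    have "i + 1 \<le> 2 ^ i" by (induction i) auto
    then have "real (i + 1) \<le> real (2 ^ i)" by (rule of_nat_mono)
    also have "\<dots> \<le> 2 ^ (i + j)" by simp
    finally have i: "real (i + 1) \<le> 2 ^ (i + j)" .
    have "norm (formal_dx h $ j $ i) = real (i + 1) * norm (h $ j $ (i + 1))"
      using norm_of_nat[of "i + 1", where 'a = complex] by (simp add: formal_dx_nth norm_mult del: norm_of_nat)
    also have "\<dots> \<le> 2 ^ (i + j) * (C * R ^ (i + 1 + j))"
      by (intro mult_mono i h(3)) (use h in auto)
    also have "\<dots> = (C * R) * (2 * R) ^ (i + j)" by (simp add: power_mult_distrib mult_ac)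
    finally show "norm (formal_dx h $ j $ i) \<le> (C * R) * (2 * R) ^ (i + j)" .
  qed (use h in auto)
qed

text \<open>The charts \<open>x = y * (t + c)\<close> miss the direction \<open>y = 0\<close>;
  exchanging the variables turns it into the direction with \<open>c = 0\<close>.\<close>

definition swap_xy :: "formal_series \<Rightarrow> formal_series" where
  "swap_xy h = Abs_fps (\<lambda>j. Abs_fps (\<lambda>i. h $ i $ j))"

lemma swap_xy_nth [simp]: "swap_xy h $ j $ i = h $ i $ j"
  by (simp add: swap_xy_def)

lemma swap_xy_swap_xy [simp]: "swap_xy (swap_xy h) = h"
  by (simp add: fps_eq_iff)

lemma swap_xy_add: "swap_xy (g + h) = swap_xy g + swap_xy h"
  by (simp add: fps_eq_iff)

lemma swap_xy_mult: "swap_xy (g * h) = swap_xy g * swap_xy h"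
proof (rule fps_ext, rule fps_ext)
  show "swap_xy (g * h) $ j $ i = (swap_xy g * swap_xy h) $ j $ i" for j i
    by (simp only: swap_xy_nth formal_mult_nth, rule sum.swap)
qed

lemma swap_xy_dx: "swap_xy (formal_dx h) = formal_dy (swap_xy h)"
  and swap_xy_dy: "swap_xy (formal_dy h) = formal_dx (swap_xy h)"
  by (simp_all add: fps_eq_iff formal_dx_nth fps_of_nat[symmetric])

lemma convergent_swap_xy: "convergent_near_0 h \<Longrightarrow> convergent_near_0 (swap_xy h)"
  unfolding convergent_near_0_iff_bound swap_xy_nth by (metis add.commute)

lemma vanishes_below_swap_xy: "vanishes_below n (swap_xy h) \<longleftrightarrow> vanishes_below n h"
  unfolding vanishes_below_def swap_xy_nth by (metis add.commute)

subsection \<open>Logarithmic factors in a chart\<close>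

lemma fps_mult_lowest:
  fixes u h :: "'a::comm_ring_1 fps"
  assumes "\<And>j. j < m \<Longrightarrow> h $ j = 0"
  shows "(u * h) $ m = u $ 0 * h $ m" and "j < m \<Longrightarrow> (u * h) $ j = 0"
proof -
  have "(u * h) $ m = (\<Sum>i\<in>{0}. u $ i * h $ (m - i))"
    unfolding fps_mult_nth by (rule sum.mono_neutral_right) (use assms in auto)
  then show "(u * h) $ m = u $ 0 * h $ m" by simp
  show "(u * h) $ j = 0" if "j < m"
    unfolding fps_mult_nth using assms that by (intro sum.neutral) auto
qed

lemma fps_mult_root_lowest:
  fixes u h :: "'a::comm_ring_1 fps"
  assumes "u $ 0 = 0" "\<And>j. j < m \<Longrightarrow> h $ j = 0"
  shows "(u * h) $ Suc m = u $ 1 * h $ m" "(u * h) $ m = 0"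
proof -
  have u: "u = fps_shift 1 u * fps_X" using assms(1) by (auto simp: fps_eq_iff)
  have "u * h = fps_shift 1 u * (fps_X * h)" by (subst u) (simp only: mult.assoc)
  moreover have "(fps_X * h) $ j = 0" if "j < Suc m" for j
    using assms(2) that by auto
  ultimately show "(u * h) $ Suc m = u $ 1 * h $ m" "(u * h) $ m = 0"
    using fps_mult_lowest(1)[of "Suc m" "fps_X * h" "fps_shift 1 u"]
      fps_mult_lowest(2)[of "Suc m" "fps_X * h" m "fps_shift 1 u"] by auto
qed

text \<open>With \<open>a\<close> the order of \<open>f\<close>, the left side has coefficient
  \<open>a * u $ 0\<close> times the lowest coefficient of \<open>f\<close> in degree
  \<open>a - 1\<close>, where the right side vanishes. Degree \<open>a\<close> then compares
  \<open>a * u $ 1\<close> with \<open>v $ 0\<close>.\<close>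

lemma fps_euler_equation:
  fixes f u v :: "complex fps"
  assumes eq: "u * fps_deriv f = v * f" and f: "f \<noteq> 0" and a: "subdegree f \<ge> 1"
  shows "u $ 0 = 0" "of_nat (subdegree f) * u $ 1 = v $ 0"
proof -
  obtain b where b: "subdegree f = Suc b" using a by (cases "subdegree f") auto
  have f0: "f $ j = 0" if "j < Suc b" for j using that b nth_less_subdegree_zero by metis
  have fb: "f $ Suc b \<noteq> 0" using f nth_subdegree_nonzero[of f] b by simp
  have d0: "fps_deriv f $ j = 0" if "j < b" for j using f0[of "Suc j"] that by simp
  have "u $ 0 * fps_deriv f $ b = (v * f) $ b"
    unfolding eq[symmetric] using fps_mult_lowest(1)[of b "fps_deriv f" u] d0 by simp
  also have "\<dots> = 0" using fps_mult_lowest(2)[of "Suc b" f b v] f0 by simp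
  finally show u0: "u $ 0 = 0" using fb by (simp del: of_nat_Suc)
  have "u $ 1 * fps_deriv f $ b = (v * f) $ Suc b"
    unfolding eq[symmetric] using fps_mult_root_lowest(1)[of u b "fps_deriv f"] d0 u0 by simp
  also have "\<dots> = v $ 0 * f $ Suc b" using fps_mult_lowest(1)[of "Suc b" f v] f0 by simp
  finally have "(of_nat (Suc b) * u $ 1) * f $ Suc b = v $ 0 * f $ Suc b"
    by (simp add: mult_ac del: of_nat_Suc)
  then show "of_nat (subdegree f) * u $ 1 = v $ 0" using fb by (simp add: b del: of_nat_Suc)
qed

lemma subdegree_fps_deriv:
  fixes f :: "complex fps"
  assumes "subdegree f = Suc b"
  shows "subdegree (fps_deriv f) = b"
proof (rule subdegreeI)
  have "f $ Suc b \<noteq> 0" using assms nth_subdegree_nonzero[of f] by fastforce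
  then show "fps_deriv f $ b \<noteq> 0" by (simp del: of_nat_Suc)
  show "fps_deriv f $ j = 0" if "j < b" for j
    using assms that nth_less_subdegree_zero[of "Suc j" f] by simp
qed

lemma y_dy_nth: "(formal_y * formal_dy h) $ j = of_nat j * h $ j"
  by (cases j) (simp_all add: formal_y_def)

text \<open>
  Dividing \<open>F\<close> by its \<open>x\<close>-derivative \<open>H\<close> with remainder \<open>R\<close>, the equation for \<open>F\<close> shows that
  \<open>A * formal_dx R + y * formal_dy R - (G - p * formal_dx G) * R\<close> is a multiple of \<open>H\<close>. If
  \<open>c * x ^ i * y ^ m\<close> is the lexicographically lowest term of \<open>R\<close>, the corresponding coefficient is
  \<open>c * (n + m - i * n / a)\<close>, which is nonzero because \<open>i < a\<close>.
\<close>

lemma log_series_multiple_of_dx: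
  assumes F: "convergent_near_0 F"
    and eq: "A * formal_dx F + formal_y * formal_dy F = G * F"
    and G0: "G $ 0 = - of_nat n"
    and F0: "F $ 0 \<noteq> 0" and a: "subdegree (F $ 0) \<ge> 2"
  obtains p where "convergent_near_0 p" "F = p * formal_dx F"
proof -
  obtain b where b: "subdegree (F $ 0) = Suc b" "b \<ge> 1" using a by (cases "subdegree (F $ 0)") auto
  define H where "H = formal_dx F"
  have H0: "H $ 0 = fps_deriv (F $ 0)" by (simp add: H_def formal_dx_nth)
  have sH: "subdegree (H $ 0) = b" unfolding H0 by (rule subdegree_fps_deriv[OF b(1)])
  have H0n: "H $ 0 \<noteq> 0" using sH b(2) by auto
  obtain p R where p: "convergent_near_0 p" and FpR: "F = p * H + R"
    and R: "\<And>j i. b \<le> i \<Longrightarrow> R $ j $ i = 0"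
    using convergent_division[of H F] F H0n convergent_formal_dx[OF F] sH unfolding H_def by metis
  \<comment> \<open>\<open>F $ 0\<close> and every multiple of \<open>H $ 0\<close> have order at
    least \<open>b\<close>, while remainders have degree below \<open>b\<close> in x. Hence every
    term of \<open>R\<close> contains y, which gives \<open>m \<noteq> 0\<close> below.\<close>
  have R0: "R $ 0 = 0"
  proof (rule fps_ext)
    fix i
    show "R $ 0 $ i = 0 $ i"
    proof (cases "i < b")
      case True
      have "(p $ 0 * H $ 0) $ i = 0"
        using fps_mult_lowest(2)[of b "H $ 0" i "p $ 0"] True sH by (metis nth_less_subdegree_zero)
      moreover have "F $ 0 $ i = 0" using True b by (intro nth_less_subdegree_zero) simp
      ultimately show ?thesis using FpR by simp
    qed (use R in simp)
  qed
  \<comment> \<open>On \<open>y = 0\<close> the equation is an Euler equation in x, which fixes the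
    linear part of \<open>A $ 0\<close>.\<close>
  have A0: "A $ 0 $ 0 = 0" "of_nat (Suc b) * A $ 0 $ 1 = - of_nat n"
  proof -
    have "A $ 0 * fps_deriv (F $ 0) = G $ 0 * F $ 0"
      using arg_cong[OF eq, of "\<lambda>h. h $ 0"] by (simp add: formal_y_def formal_dx_nth)
    from fps_euler_equation[OF this F0]
    show "A $ 0 $ 0 = 0" "of_nat (Suc b) * A $ 0 $ 1 = - of_nat n"
      unfolding b(1) by (simp_all add: G0 fps_of_nat[symmetric])
  qed
  \<comment> \<open>This is the factor multiplying \<open>R\<close> once \<open>F\<close> is
    replaced by \<open>p * H + R\<close> in the equations for \<open>F\<close> and \<open>H\<close>;
    all other terms contain \<open>H\<close>.\<close>
  define W where "W = G - p * formal_dx G"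
  have W0: "W $ 0 = - of_nat n"
    by (simp add: W_def G0 formal_dx_nth)
  define E where "E = A * formal_dx R + formal_y * formal_dy R - W * R"
  have "A * formal_dx H + formal_dx A * H + formal_y * formal_dy H = G * H + formal_dx G * F"
    using arg_cong[OF eq, of formal_dx] by (simp add: H_def formal_dx_dy algebra_simps)
  then have dH: "A * formal_dx H + formal_y * formal_dy H = G * H + formal_dx G * F - formal_dx A * H"
    by (simp add: algebra_simps)
  have R_eq: "R = F - p * H" using FpR by simp
  have "E = (A * formal_dx F + formal_y * formal_dy F) - p * (A * formal_dx H + formal_y * formal_dy H)
      - (A * formal_dx p + formal_y * formal_dy p) * H - W * R"
    unfolding E_def R_eq by (simp add: algebra_simps)
  also have "\<dots> = (p * formal_dx A - p * p * formal_dx G - (A * formal_dx p + formal_y * formal_dy p)) * H"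
    unfolding eq dH W_def R_eq by (simp add: algebra_simps)
  finally have "\<exists>K. E = K * H" by (rule exI)
  then obtain K where K: "E = K * H" ..
  have "R = 0"
  proof (rule ccontr)
    assume "R \<noteq> 0"
    define m where "m = subdegree R"
    define r where "r = R $ m"
    have r: "r \<noteq> 0" using \<open>R \<noteq> 0\<close> by (simp add: r_def m_def)
    have m: "R $ j = 0" if "j < m" for j using that unfolding m_def by (rule nth_less_subdegree_zero)
    have "m \<noteq> 0"
    proof
      assume "m = 0"
      then show False using R0 r by (simp add: r_def)
    qed
    define i where "i = subdegree r"
    have i: "r $ l = 0" if "l < i" for l using that unfolding i_def by (rule nth_less_subdegree_zero)
    have ri: "r $ i \<noteq> 0" using r unfolding i_def by (rule nth_subdegree_nonzero)
    then have "i < b" using R[of i m] by (metis r_def not_le)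
    have low: "E $ j = 0" if "j < m" for j
      using m that fps_mult_lowest(2)[of m R j W] fps_mult_lowest(2)[of m "formal_dx R" j A]
      by (simp add: E_def y_dy_nth formal_dx_nth)
    have "E $ m = A $ 0 * fps_deriv r + of_nat m * r + of_nat n * r"
      using m fps_mult_lowest(1)[of m R W] fps_mult_lowest(1)[of m "formal_dx R" A]
      by (simp add: E_def y_dy_nth formal_dx_nth W0 r_def)
    then have "E $ m $ i = (A $ 0 * fps_deriv r) $ i + of_nat m * r $ i + of_nat n * r $ i"
      by (simp add: fps_of_nat[symmetric])
    moreover have "(A $ 0 * fps_deriv r) $ i = A $ 0 $ 1 * (of_nat i * r $ i)"
    proof (cases i)
      case (Suc l)
      have "fps_deriv r $ j = 0" if "j < l" for j using that i Suc by simp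
      then show ?thesis using fps_mult_root_lowest(1)[OF A0(1), of l "fps_deriv r"] Suc by simp
    qed (simp add: A0)
    ultimately have "(A $ 0 $ 1 * of_nat i + of_nat m + of_nat n) * r $ i = 0"
      using multiple_lowest_coeff[of m K H i] low H0n sH \<open>i < b\<close> unfolding K by (simp add: algebra_simps)
    \<comment> \<open>Multiplying by \<open>Suc b\<close> turns the resonance into an identity of
      natural numbers, impossible for \<open>i < Suc b\<close> and
      \<open>m \<noteq> 0\<close>.\<close>
    then have "of_nat (Suc b) * (A $ 0 $ 1 * of_nat i + of_nat m + of_nat n) = 0" using ri by simp
    then have "(of_nat (Suc b) * A $ 0 $ 1) * of_nat i + of_nat (Suc b) * (of_nat m + of_nat n) = 0"
      by (simp add: algebra_simps)
    then have "complex_of_nat (Suc b * (m + n)) = of_nat (n * i)" unfolding A0(2) by (simp add: algebra_simps)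
    then have "Suc b * (m + n) = n * i" unfolding of_nat_eq_iff .
    moreover have "n * i \<le> n * Suc b" by (rule mult_le_mono2) (use \<open>i < b\<close> in simp)
    moreover have "Suc b * (m + n) = Suc b * m + n * Suc b" by (simp add: algebra_simps)
    moreover have "m \<le> Suc b * m" by simp
    ultimately show False using \<open>m \<noteq> 0\<close> by linarith
  qed
  from FpR have "F = p * formal_dx F" unfolding H_def \<open>R = 0\<close> add_0_right .
  with p show ?thesis by (rule that)
qed

text \<open>\<open>\<rho>\<close> is a series in y alone. Its lowest coefficient is only scaled by
  \<open>q $ 0 $ 0\<close> in the constant term of the product, whereas the lowest coefficient of a
  multiple of \<open>P\<close> has constant term zero.\<close>

lemma remainder_zero:
  fixes q \<rho> L P :: formal_series
  assumes eq: "q * \<rho> = L * P" and q: "q $ 0 $ 0 \<noteq> 0" and \<rho>: "\<And>j i. 1 \<le> i \<Longrightarrow> \<rho> $ j $ i = 0"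
    and P: "subdegree (P $ 0) = 1"
  shows "\<rho> = 0"
proof (rule ccontr)
  assume "\<rho> \<noteq> 0"
  define m where "m = subdegree \<rho>"
  have low: "\<rho> $ j = 0" if "j < m" for j using that unfolding m_def by (rule nth_less_subdegree_zero)
  have "P $ 0 \<noteq> 0" using P by auto
  then have "(q * \<rho>) $ m $ 0 = 0"
    unfolding eq using multiple_lowest_coeff[of m L P 0] fps_mult_lowest(2)[of m \<rho> _ q] low P
    unfolding eq by simp
  then have "\<rho> $ m $ 0 = 0" using fps_mult_lowest(1)[of m \<rho> q] low q by simp
  then have "\<rho> $ m = 0"
    using \<rho>[of _ m] by (metis fps_ext fps_zero_nth less_one not_le)
  then show False using \<open>\<rho> \<noteq> 0\<close> by (simp add: m_def)
qed

text \<open>If \<open>F\<close> looks like \<open>(x - \<sigma>) ^ a\<close>, then \<open>p\<close>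
  looks like \<open>(x - \<sigma>) / a\<close>; so dividing x by \<open>p\<close> gives
  \<open>\<sigma>\<close> as remainder and a unit \<open>q\<close> with value \<open>a\<close> at 0.
  From \<open>q * F = P * formal_dx F\<close> it follows that \<open>P\<close> divides
  \<open>F\<close>, and the cofactor satisfies the same equation with \<open>q - 1\<close>, still a
  unit as \<open>a \<ge> 2\<close>. Hence \<open>P\<close> divides twice.\<close>

lemma square_factor_in_chart:
  assumes F: "convergent_near_0 F" and p: "convergent_near_0 p" and Fp: "F = p * formal_dx F"
    and F0: "F $ 0 \<noteq> 0" and a: "subdegree (F $ 0) \<ge> 2"
  obtains \<sigma> K where "convergent_near_0 \<sigma>" "\<And>j i. 1 \<le> i \<Longrightarrow> \<sigma> $ j $ i = 0" "\<sigma> $ 0 = 0"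
    "F = K * (formal_x - \<sigma>) ^ 2"
proof -
  have p0: "p $ 0 $ 0 = 0" "of_nat (subdegree (F $ 0)) * p $ 0 $ 1 = 1"
  proof -
    have "p $ 0 * fps_deriv (F $ 0) = 1 * F $ 0"
      using arg_cong[OF Fp, of "\<lambda>h. h $ 0"] by (simp add: formal_dx_nth)
    from fps_euler_equation[OF this F0] a
    show "p $ 0 $ 0 = 0" "of_nat (subdegree (F $ 0)) * p $ 0 $ 1 = 1" by auto
  qed
  then have p1: "p $ 0 $ 1 \<noteq> 0" by auto
  then have sp: "subdegree (p $ 0) = 1" using p0 by (intro subdegreeI) auto
  then have "p $ 0 \<noteq> 0" by auto
  then obtain q \<sigma> where q: "formal_x = q * p + \<sigma>" "convergent_near_0 \<sigma>"
    and \<sigma>: "\<And>j i. 1 \<le> i \<Longrightarrow> \<sigma> $ j $ i = 0"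
    using convergent_division[OF p convergent_near_0_x] sp by metis
  have q0: "fps_X = q $ 0 * p $ 0 + \<sigma> $ 0"
    using arg_cong[OF q(1), of "\<lambda>h. h $ 0"] by (simp add: formal_x_def)
  have "\<sigma> $ 0 $ 0 = 0" using arg_cong[OF q0, of "\<lambda>h. h $ 0"] p0 by simp
  then have \<sigma>0: "\<sigma> $ 0 = 0" using \<sigma>[of _ 0] by (metis fps_ext fps_zero_nth less_one not_le)
  have "1 = q $ 0 $ 0 * p $ 0 $ 1"
    using arg_cong[OF q0, of "\<lambda>h. h $ 1"] p0 by (simp add: \<sigma>0 fps_mult_nth)
  then have q00: "q $ 0 $ 0 = of_nat (subdegree (F $ 0))"
    using p0(2) p1 by (metis mult_right_cancel)
  define P where "P = formal_x - \<sigma>"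
  have P: "P = q * p" unfolding P_def by (subst q(1)) simp
  have Pc: "convergent_near_0 P"
    unfolding P_def by (intro convergent_near_0_diff convergent_near_0_x q)
  have "formal_dx \<sigma> = 0" using \<sigma> by (simp add: fps_eq_iff formal_dx_nth)
  then have dP: "formal_dx P = 1" by (simp add: P_def)
  have P0: "P $ 0 = fps_X" by (simp add: P_def formal_x_def \<sigma>0)
  have sP: "subdegree (P $ 0) = 1" and P0n: "P $ 0 \<noteq> 0" by (simp_all add: P0)
  obtain K \<rho> where K: "convergent_near_0 K" "F = K * P + \<rho>" and \<rho>: "\<And>j i. 1 \<le> i \<Longrightarrow> \<rho> $ j $ i = 0"
    using convergent_division[OF Pc F P0n] sP by metis
  have "q * F = formal_dx F * P" by (subst Fp) (simp add: P mult_ac)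
  then have "q * \<rho> = (formal_dx F - q * K) * P" using K(2) by (simp add: algebra_simps)
  then have "\<rho> = 0" by (rule remainder_zero) (use q00 a \<rho> sP in auto)
  then have FK: "F = K * P" using K by simp
  obtain K' \<rho>' where K': "K = K' * P + \<rho>'" and \<rho>': "\<And>j i. 1 \<le> i \<Longrightarrow> \<rho>' $ j $ i = 0"
    using convergent_division[OF Pc K(1) P0n] sP by metis
  have "P * (q * K) = P * (K + P * formal_dx K)"
    using \<open>q * F = formal_dx F * P\<close> unfolding FK by (simp add: dP algebra_simps)
  then have "q * K = K + P * formal_dx K" using P0n by auto
  then have "(q - 1) * \<rho>' = (formal_dx K - (q - 1) * K') * P"
    using K' by (simp add: algebra_simps)
  moreover have "(q - 1) $ 0 $ 0 \<noteq> 0"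
  proof
    assume "(q - 1) $ 0 $ 0 = 0"
    then have "complex_of_nat (subdegree (F $ 0)) = of_nat 1" by (simp add: q00)
    then have "subdegree (F $ 0) = 1" unfolding of_nat_eq_iff .
    then show False using a by simp
  qed
  ultimately have "\<rho>' = 0" using \<rho>' sP by (intro remainder_zero)
  then have "F = K' * P ^ 2" using FK K' by (simp add: power2_eq_square mult_ac)
  then show ?thesis using that q(2) \<sigma> \<sigma>0 P_def by blast
qed

text \<open>The chain rule lifts the vector field to the chart. The term
  \<open>of_nat n * \<beta>'\<close> comes from differentiating the factor \<open>y ^ n\<close> that
  is split off from \<open>blowup c f\<close>.\<close>

lemma blown_up_equation:
  fixes c :: complex
  assumes f: "vanishes_below n f"
    and v: "vanishes_below 1 \<alpha>" "vanishes_below 1 \<beta>" "vanishes_below 1 g"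
    and eq: "\<alpha> * formal_dx f + \<beta> * formal_dy f = g * f"
  defines "F \<equiv> fps_shift n (blowup c f)"
    and "\<alpha>' \<equiv> fps_shift 1 (blowup c \<alpha>)" and "\<beta>' \<equiv> fps_shift 1 (blowup c \<beta>)"
    and "g' \<equiv> fps_shift 1 (blowup c g)"
  shows "(\<alpha>' - (formal_x + formal_const c) * \<beta>') * formal_dx F + \<beta>' * (formal_y * formal_dy F)
     = (formal_y * g' - of_nat n * \<beta>') * F"
proof -
  let ?Z = "formal_x + formal_const c"
  let ?fx = "formal_y * blowup c (formal_dx f)" and ?fy = "formal_y * blowup c (formal_dy f)"
  have Bf: "blowup c f = formal_y ^ n * F"
    unfolding F_def by (rule blowup_shift[OF f])
  have B: "blowup c \<alpha> = formal_y * \<alpha>'" "blowup c \<beta> = formal_y * \<beta>'" "blowup c g = formal_y * g'"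
    unfolding \<alpha>'_def \<beta>'_def g'_def using v[THEN blowup_shift, of c] by simp_all
  have fx: "?fx = formal_y ^ n * formal_dx F"
    using formal_dx_blowup[of c f, unfolded Bf formal_dx_power_y] by (rule sym)
  have "formal_y * formal_dy (blowup c f) = ?Z * ?fx + ?fy"
    unfolding formal_dy_blowup by (simp add: algebra_simps)
  then have fy: "?Z * ?fx + ?fy = formal_y ^ n * (of_nat n * F + formal_y * formal_dy F)"
    unfolding Bf formal_y_dy_power_y by simp
  have "blowup c \<alpha> * blowup c (formal_dx f) + blowup c \<beta> * blowup c (formal_dy f) = blowup c g * blowup c f"
    using arg_cong[OF eq, of "blowup c"] by (simp add: blowup_add blowup_mult)
  then have "\<alpha>' * ?fx + \<beta>' * ?fy = formal_y * g' * (formal_y ^ n * F)"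
    unfolding B Bf by (simp add: mult_ac)
  then have "(\<alpha>' - ?Z * \<beta>') * ?fx + \<beta>' * (?Z * ?fx + ?fy) = formal_y * g' * (formal_y ^ n * F)"
    by (simp add: algebra_simps)
  then have "formal_y ^ n * ((\<alpha>' - ?Z * \<beta>') * formal_dx F + \<beta>' * (formal_y * formal_dy F))
      = formal_y ^ n * ((formal_y * g' - of_nat n * \<beta>') * F)"
    unfolding fy unfolding fx by (simp add: algebra_simps)
  moreover have "formal_y ^ n \<noteq> 0" by (simp add: formal_y_def)
  ultimately show ?thesis using mult_left_cancel by blast
qed

text \<open>
  The blow-up is linear in \<open>x\<close> on remainders of degree less than two in \<open>x\<close>; hence a square factor
  \<open>(x - \<sigma>)\<^sup>2\<close> on the blow-up descends to the square factor \<open>(x - c * y - y * \<sigma>)\<^sup>2\<close>.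
\<close>

lemma square_factor_blow_down:
  assumes f: "convergent_near_0 f" and \<sigma>: "convergent_near_0 \<sigma>" "\<And>j i. 1 \<le> i \<Longrightarrow> \<sigma> $ j $ i = 0" "\<sigma> $ 0 = 0"
    and K: "blowup c f = K * (formal_x - \<sigma>) ^ 2"
  obtains p Q where "convergent_near_0 p" "convergent_near_0 Q" "f = Q * p ^ 2" "p $ 0 $ 0 = 0"
proof -
  define P where "P = formal_x - \<sigma>"
  define p where "p = formal_x - formal_y * (formal_const c + \<sigma>)"
  have pc: "convergent_near_0 p"
    unfolding p_def by (intro convergent_near_0_diff convergent_near_0_add convergent_near_0_mult convergent_near_0_x
        convergent_near_0_y convergent_near_0_const \<sigma>)
  have p0: "p $ 0 = fps_X" by (simp add: p_def formal_x_def formal_y_def)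
  have Bp: "blowup c p = formal_y * P"
  proof -
    have "blowup c formal_x = formal_y * (formal_x + formal_const c)"
      using blowup_x_mult[of c 1] blowup_const[of c 1] by (simp add: formal_const_def)
    moreover have "blowup c \<sigma> = \<sigma>" using \<sigma> by (intro blowup_eq_self) auto
    ultimately show ?thesis
      by (simp add: p_def P_def blowup_diff blowup_y_mult blowup_add blowup_const algebra_simps)
  qed
  have p2: "(p ^ 2) $ 0 = fps_X ^ 2" by (simp add: p0 power2_eq_square)
  then have p2n: "(p ^ 2) $ 0 \<noteq> 0" and sp2: "subdegree ((p ^ 2) $ 0) = 2"
    by (simp_all add: subdegree_power)
  have p2c: "convergent_near_0 (p ^ 2)" by (simp add: power2_eq_square convergent_near_0_mult pc)
  obtain Q R where Q: "convergent_near_0 Q" "f = Q * p ^ 2 + R" and R: "\<And>j i. 2 \<le> i \<Longrightarrow> R $ j $ i = 0"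
    using convergent_division[OF p2c f p2n] sp2 by metis
  define u v where "u = Abs_fps (\<lambda>j. fps_const (R $ j $ 0))" and "v = Abs_fps (\<lambda>j. fps_const (R $ j $ 1))"
  have R_eq: "R = u + formal_x * v"
  proof (rule fps_ext, rule fps_ext)
    fix j i :: nat
    have "i = 0 \<or> i = 1 \<or> 2 \<le> i" by linarith
    then show "R $ j $ i = (u + formal_x * v) $ j $ i"
      using R[of i j] by (auto simp: u_def v_def formal_x_mult_nth)
  qed
  have "blowup c u = u" "blowup c v = v" by (auto intro!: blowup_eq_self simp: u_def v_def)
  then have BR: "blowup c R = u + formal_y * ((formal_x + formal_const c) * v)"
    by (simp add: R_eq blowup_add blowup_x_mult)
  have BR_nth: "blowup c R $ d = fps_const (R $ d $ 0) + (if d = 0 then 0 else (fps_X + fps_const c) * fps_const (R $ (d - 1) $ 1))" for d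
    unfolding BR fps_add_nth formal_y_mult_nth
    by (simp add: u_def v_def distrib_right formal_x_mult_nth formal_const_def)
  have "blowup c R = (K - formal_y ^ 2 * blowup c Q) * P ^ 2"
  proof -
    have "blowup c f = blowup c Q * (blowup c p) ^ 2 + blowup c R"
      unfolding Q(2) by (simp add: blowup_add blowup_mult power2_eq_square)
    then show ?thesis unfolding K Bp P_def[symmetric] by (simp add: power_mult_distrib algebra_simps)
  qed
  then obtain L where L: "blowup c R = L * P ^ 2" by blast
  have "(P ^ 2) $ 0 = fps_X ^ 2" by (simp add: P_def power2_eq_square formal_x_def \<sigma>)
  then have P2: "(P ^ 2) $ 0 \<noteq> 0" "subdegree ((P ^ 2) $ 0) = 2"
    by (simp_all add: subdegree_power)
  \<comment> \<open>The lowest coefficient of a multiple of \<open>P ^ 2\<close> has no terms of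
    degree below two in x, and by \<open>BR_nth\<close> none of degree two or more.\<close>
  have BR0: "blowup c R = 0"
  proof (rule ccontr)
    assume ne: "blowup c R \<noteq> 0"
    define m where "m = subdegree (blowup c R)"
    have "blowup c R $ m $ i = 0" for i
    proof (cases "i < 2")
      case True
      then show ?thesis
        using multiple_lowest_coeff[of m L "P ^ 2" i] P2 nth_less_subdegree_zero[of _ "blowup c R"]
        unfolding m_def L by simp
    next
      case False
      then show ?thesis unfolding BR_nth by auto
    qed
    then have "blowup c R $ m = 0" by (simp add: fps_eq_iff)
    then show False using ne by (simp add: m_def)
  qed
  have v0: "R $ j $ 1 = 0" for j
    using BR_nth[of "Suc j", unfolded BR0] by (auto dest: arg_cong[of _ _ "\<lambda>h. h $ 1"])
  have u0: "R $ j $ 0 = 0" for j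
    using arg_cong[OF BR_nth[of j, unfolded BR0], of "\<lambda>h. h $ 0"] v0 by (auto split: if_splits)
  have "R = 0" unfolding R_eq by (simp add: fps_eq_iff u_def v_def u0 v0[simplified] formal_x_mult_nth)
  then show ?thesis using that pc Q p0 by auto
qed

text \<open>The last hypothesis makes \<open>\<beta>'\<close> a unit in the chart. Dividing the
  blown-up equation by it gives coefficient one at \<open>y * formal_dy\<close>, and
  \<open>G\<close> is \<open>- n\<close> on \<open>y = 0\<close>.\<close>

lemma square_factor_of_double_direction:
  assumes f: "convergent_near_0 f" "vanishes_below n f"
    and v: "vanishes_below 1 \<alpha>" "vanishes_below 1 \<beta>" "vanishes_below 1 g"
    and eq: "\<alpha> * formal_dx f + \<beta> * formal_dy f = g * f"
    and ne: "blowup c f $ n \<noteq> 0" and dbl: "blowup c f $ n $ 0 = 0" "blowup c f $ n $ 1 = 0"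
    and \<beta>: "blowup c \<beta> $ 1 $ 0 \<noteq> 0"
  obtains p Q where "convergent_near_0 p" "convergent_near_0 Q" "f = Q * p ^ 2" "p $ 0 $ 0 = 0"
proof -
  define F where "F = fps_shift n (blowup c f)"
  define \<alpha>' where "\<alpha>' = fps_shift 1 (blowup c \<alpha>)"
  define \<beta>' where "\<beta>' = fps_shift 1 (blowup c \<beta>)"
  define g' where "g' = fps_shift 1 (blowup c g)"
  note eq' = blown_up_equation[OF f(2) v eq, of c, folded F_def \<alpha>'_def \<beta>'_def g'_def]
  have "\<beta>' $ 0 * inverse (\<beta>' $ 0) = 1"
    using \<beta> inverse_mult_eq_1'[of "\<beta>' $ 0"] by (simp add: \<beta>'_def)
  then obtain V where V: "\<beta>' * V = 1" using fps_right_inverse by blast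
  define G where "G = V * (formal_y * g') - of_nat n"
  have "V * (\<alpha>' - (formal_x + formal_const c) * \<beta>') * formal_dx F + (\<beta>' * V) * (formal_y * formal_dy F)
      = V * (formal_y * g') * F - of_nat n * (\<beta>' * V) * F"
    using arg_cong[OF eq', of "\<lambda>h. V * h"] by (simp add: algebra_simps)
  then have log: "V * (\<alpha>' - (formal_x + formal_const c) * \<beta>') * formal_dx F + formal_y * formal_dy F = G * F"
    unfolding V G_def by (simp add: algebra_simps)
  have G0: "G $ 0 = - of_nat n" by (simp add: G_def formal_y_def)
  have F0: "F $ 0 = blowup c f $ n" by (simp add: F_def)
  have "F $ 0 $ j = 0" if "j < 2" for j using that dbl by (auto simp: F0 less_2_cases_iff)
  then have sF: "subdegree (F $ 0) \<ge> 2" using ne F0 by (intro subdegree_geI) auto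
  have Fc: "convergent_near_0 F"
    unfolding F_def by (intro convergent_fps_shift convergent_blowup f)
  have F0n: "F $ 0 \<noteq> 0" using ne F0 by simp
  obtain p where p: "convergent_near_0 p" "F = p * formal_dx F"
    by (rule log_series_multiple_of_dx[OF Fc log G0 F0n sF])
  obtain \<sigma> K where \<sigma>: "convergent_near_0 \<sigma>" "\<And>j i. 1 \<le> i \<Longrightarrow> \<sigma> $ j $ i = 0" "\<sigma> $ 0 = 0"
    and K: "F = K * (formal_x - \<sigma>) ^ 2"
    by (rule square_factor_in_chart[OF Fc p F0n sF]) blast
  have "blowup c f = (formal_y ^ n * K) * (formal_x - \<sigma>) ^ 2"
    using blowup_shift[OF f(2), of c, folded F_def] K by (simp add: mult.assoc)
  from square_factor_blow_down[OF f(1) \<sigma> this] that show ?thesis by blast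
qed

subsection \<open>Multiple directions of the tangent cone\<close>

text \<open>The square of the matrix of linear parts of \<open>\<alpha>\<close> and \<open>\<beta>\<close> is zero.\<close>

definition nilpotent_linear_part :: "formal_series \<Rightarrow> formal_series \<Rightarrow> bool" where
  "nilpotent_linear_part \<alpha> \<beta> \<longleftrightarrow>
     \<alpha> $ 0 $ 1 * \<alpha> $ 0 $ 1 + \<alpha> $ 1 $ 0 * \<beta> $ 0 $ 1 = 0 \<and>
     \<alpha> $ 0 $ 1 * \<alpha> $ 1 $ 0 + \<alpha> $ 1 $ 0 * \<beta> $ 1 $ 0 = 0 \<and>
     \<beta> $ 0 $ 1 * \<alpha> $ 0 $ 1 + \<beta> $ 1 $ 0 * \<beta> $ 0 $ 1 = 0 \<and>
     \<beta> $ 0 $ 1 * \<alpha> $ 1 $ 0 + \<beta> $ 1 $ 0 * \<beta> $ 1 $ 0 = 0"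

text \<open>The homogeneous part of degree \<open>n\<close>, evaluated at \<open>(z, 1)\<close>. If
  it is nonzero, the drop of the degree below \<open>n\<close> is the multiplicity of its factor
  y.\<close>

definition dehomogenize :: "nat \<Rightarrow> formal_series \<Rightarrow> complex poly" where
  "dehomogenize n h = (\<Sum>i\<le>n. monom (h $ (n - i) $ i) i)"

lemma coeff_dehomogenize: "coeff (dehomogenize n h) i = (if i \<le> n then h $ (n - i) $ i else 0)"
  by (simp add: dehomogenize_def coeff_sum)

lemma degree_dehomogenize_le: "degree (dehomogenize n h) \<le> n"
  by (rule degree_le) (simp add: coeff_dehomogenize)

lemma blowup_nth_dehomogenize: "blowup c h $ n = fps_of_poly (dehomogenize n h \<circ>\<^sub>p [:c, 1:])"
proof -
  have lin: "fps_of_poly [:c, 1:] = fps_X + fps_const c"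
    by (auto simp: fps_eq_iff coeff_pCons fps_X_def split: nat.splits)
  have monom: "monom a i \<circ>\<^sub>p q = smult a (q ^ i)" for a i and q :: "complex poly"
    by (induction i) (simp_all add: monom_0 monom_Suc pcompose_pCons)
  show ?thesis
    by (simp add: dehomogenize_def pcompose_sum fps_of_poly_sum monom fps_of_poly_smult fps_of_poly_power
        lin blowup_nth)
qed

lemma blowup_nth_eq_0_iff: "blowup c h $ n = 0 \<longleftrightarrow> dehomogenize n h = 0"
  using pcompose_eq_0_iff[of "[:c, 1:]" "dehomogenize n h"] fps_of_poly_eq_iff[of _ 0]
  by (simp add: blowup_nth_dehomogenize)

lemma blowup_nth_0: "blowup c h $ n $ 0 = poly (dehomogenize n h) c"
  by (simp add: blowup_nth_dehomogenize)

lemma blowup_nth_1: "blowup c h $ n $ 1 = poly (pderiv (dehomogenize n h)) c"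
proof -
  have "blowup c h $ n $ 1 = poly (pderiv (dehomogenize n h \<circ>\<^sub>p [:c, 1:])) 0"
    by (simp add: blowup_nth_dehomogenize poly_0_coeff_0 coeff_pderiv)
  also have "\<dots> = poly (pderiv (dehomogenize n h)) c"
    by (simp add: pderiv_pcompose pderiv_pCons poly_pcompose)
  finally show ?thesis .
qed

lemma blowup_nth_linear:
  "blowup c h $ 1 = fps_const (h $ 1 $ 0) + fps_const (h $ 0 $ 1) * (fps_X + fps_const c)"
  by (simp add: blowup_nth)

text \<open>The blown-up equation restricted to \<open>y = 0\<close>; the term with \<open>g\<close>
  drops out because \<open>g\<close> vanishes at the origin.\<close>

lemma initial_form_equation:
  assumes f: "vanishes_below n f"
    and v: "vanishes_below 1 \<alpha>" "vanishes_below 1 \<beta>" "vanishes_below 1 g"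
    and eq: "\<alpha> * formal_dx f + \<beta> * formal_dy f = g * f"
  shows "(blowup c \<alpha> $ 1 - (fps_X + fps_const c) * blowup c \<beta> $ 1) * fps_deriv (blowup c f $ n)
    = (- of_nat n * blowup c \<beta> $ 1) * blowup c f $ n"
  using arg_cong[OF blown_up_equation[OF f v eq, of c], of "\<lambda>h. h $ 0"]
  by (simp add: formal_dx_nth formal_x_def formal_y_def formal_const_def)

text \<open>The Euler equation makes \<open>?u\<close> vanish to order two at the direction. With
  the last hypothesis, the value of \<open>?u\<close> puts \<open>(c, 1)\<close> into the kernel of
  the linear part and its linear coefficient makes the trace zero; such a matrix has square
  zero.\<close>

lemma double_direction_regular:
  assumes f: "vanishes_below n f"
    and v: "vanishes_below 1 \<alpha>" "vanishes_below 1 \<beta>" "vanishes_below 1 g"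
    and eq: "\<alpha> * formal_dx f + \<beta> * formal_dy f = g * f"
    and ne: "blowup c f $ n \<noteq> 0" and dbl: "blowup c f $ n $ 0 = 0" "blowup c f $ n $ 1 = 0"
    and \<beta>: "blowup c \<beta> $ 1 $ 0 = 0"
  shows "nilpotent_linear_part \<alpha> \<beta>"
proof -
  let ?u = "blowup c \<alpha> $ 1 - (fps_X + fps_const c) * blowup c \<beta> $ 1"
  have "blowup c f $ n $ j = 0" if "j < 2" for j using that dbl by (auto simp: less_2_cases_iff)
  then have s: "subdegree (blowup c f $ n) \<ge> 2" using ne by (intro subdegree_geI) auto
  have 0: "?u $ 0 = 0"
    by (rule fps_euler_equation(1)[OF initial_form_equation[OF f v eq] ne]) (use s in simp)
  have "of_nat (subdegree (blowup c f $ n)) * ?u $ 1 = (- of_nat n * blowup c \<beta> $ 1) $ 0"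
    by (rule fps_euler_equation(2)[OF initial_form_equation[OF f v eq] ne]) (use s in simp)
  also have "\<dots> = 0" using \<beta> by simp
  finally have 1: "?u $ 1 = 0" using s by auto
  note nth = blowup_nth_linear
  have b: "\<beta> $ 1 $ 0 = - (\<beta> $ 0 $ 1 * c)" using \<beta> unfolding nth by (simp add: eq_neg_iff_add_eq_0)
  have a: "\<alpha> $ 1 $ 0 = - (\<alpha> $ 0 $ 1 * c)" using 0 \<beta> unfolding nth by (simp add: eq_neg_iff_add_eq_0)
  have "\<alpha> $ 0 $ 1 - (\<beta> $ 1 $ 0 + 2 * c * \<beta> $ 0 $ 1) = 0"
    using 1 unfolding nth by (simp add: distrib_right distrib_left algebra_simps)
  then have l: "\<alpha> $ 0 $ 1 = \<beta> $ 0 $ 1 * c" using b by (simp add: algebra_simps)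
  show ?thesis unfolding nilpotent_linear_part_def a b unfolding l by (simp add: algebra_simps)
qed

lemma rsquarefree_degree:
  fixes p :: "complex poly"
  assumes "rsquarefree p"
  shows "degree p = card {z. poly p z = 0}"
proof -
  have "p \<noteq> 0" using assms by (simp add: rsquarefree_def)
  then have "degree p = degree (\<Prod>z | poly p z = 0. [:- z, 1:])"
    by (subst (1) complex_poly_decompose_rsquarefree[OF assms, symmetric]) simp
  also have "\<dots> = (\<Sum>z | poly p z = 0. degree [:- z, 1:])"
    by (rule degree_prod_eq_sum_degree) auto
  finally show ?thesis by simp
qed

text \<open>
  The roots of \<open>p = dehomogenize n f\<close> are roots of the quadratic \<open>u\<close> that describes the eigenvectors
  of the linear part, apart from the multiple ones; since \<open>n \<ge> 3\<close>, there are too few of them.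
\<close>

lemma multiple_direction_cases:
  assumes n: "n \<ge> 3" and f: "vanishes_below n f"
    and v: "vanishes_below 1 \<alpha>" "vanishes_below 1 \<beta>" "vanishes_below 1 g"
    and eq: "\<alpha> * formal_dx f + \<beta> * formal_dy f = g * f"
    and p0: "dehomogenize n f \<noteq> 0" and L: "\<not> nilpotent_linear_part \<alpha> \<beta>"
  shows "(\<exists>c. poly (dehomogenize n f) c = 0 \<and> poly (pderiv (dehomogenize n f)) c = 0)
    \<or> degree (dehomogenize n f) + 2 \<le> n"
proof (rule ccontr)
  define p where "p = dehomogenize n f"
  assume "\<not> ?thesis"
  then have simple: "\<And>c. \<not> (poly p c = 0 \<and> poly (pderiv p) c = 0)" and d: "degree p + 2 > n"
    unfolding p_def by (blast, simp)
  define l11 l12 l21 l22 where l: "l11 = \<alpha> $ 0 $ 1" "l12 = \<alpha> $ 1 $ 0" "l21 = \<beta> $ 0 $ 1" "l22 = \<beta> $ 1 $ 0"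
  define u where "u = [:l12, l11 - l22, - l21:]"
  have p: "blowup 0 f $ n = fps_of_poly p" by (simp add: blowup_nth_dehomogenize p_def)
  have "fps_of_poly u = blowup 0 \<alpha> $ 1 - (fps_X + fps_const 0) * blowup 0 \<beta> $ 1"
    unfolding blowup_nth_linear u_def l
    by (simp add: fps_of_poly_pCons algebra_simps flip: fps_const_sub fps_const_neg)
  moreover have "fps_of_poly [:l22, l21:] = blowup 0 \<beta> $ 1"
    unfolding blowup_nth_linear l by (simp add: fps_of_poly_pCons)
  ultimately have "fps_of_poly (u * pderiv p) = fps_of_poly (smult (- of_nat n) ([:l22, l21:] * p))"
    using initial_form_equation[OF f v eq, of 0]
    unfolding p fps_of_poly_mult fps_of_poly_pderiv fps_of_poly_smult
    by (simp add: fps_of_nat mult.assoc flip: fps_const_neg)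
  then have rel: "u * pderiv p = smult (- of_nat n) ([:l22, l21:] * p)" by (simp only: fps_of_poly_eq_iff)
  have pn: "p \<noteq> 0" using p0 by (simp add: p_def)
  \<comment> \<open>If \<open>u\<close> were zero, the linear part would be scalar, and
    \<open>rel\<close> would then make it zero.\<close>
  have u0: "u \<noteq> 0"
  proof
    assume u: "u = 0"
    then have "smult (- of_nat n) ([:l22, l21:] * p) = 0" using rel by (metis mult_zero_left)
    then have "[:l22, l21:] * p = 0" using n by (metis neg_equal_0_iff_equal not_numeral_le_zero of_nat_eq_0_iff smult_eq_0_iff)
    then have "[:l22, l21:] = 0" using pn by (metis mult_eq_0_iff)
    then have "l11 = 0 \<and> l12 = 0 \<and> l21 = 0 \<and> l22 = 0" using u by (simp add: u_def)
    then show False using L by (simp add: nilpotent_linear_part_def l)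
  qed
  have "{z. poly p z = 0} \<subseteq> {z. poly u z = 0}"
  proof
    fix z assume "z \<in> {z. poly p z = 0}"
    then show "z \<in> {z. poly u z = 0}"
      using arg_cong[OF rel, of "\<lambda>q. poly q z"] simple[of z] by auto
  qed
  then have "card {z. poly p z = 0} \<le> card {z. poly u z = 0}"
    by (intro card_mono poly_roots_finite u0)
  also have "\<dots> \<le> degree u" by (rule card_poly_roots_bound[OF u0])
  finally have pu: "degree p \<le> degree u"
    using rsquarefree_degree simple by (simp add: rsquarefree_roots)
  have u2: "degree u \<le> 2" by (simp add: u_def)
  \<comment> \<open>So y is a simple factor of the initial form. Comparing top coefficients shows
    that \<open>y = 0\<close> is itself an eigendirection, which lowers the degree of
    \<open>u\<close> to at most one.\<close>
  have deg: "degree p + 1 = n" using d pu u2 n degree_dehomogenize_le[of n f] unfolding p_def by linarith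
  define m where "m = degree p - 1"
  have m: "degree p = Suc m" using deg n by (simp add: m_def)
  have top: "coeff p (Suc m) \<noteq> 0" using pn m by (metis leading_coeff_neq_0)
  have high: "coeff p (Suc (Suc m)) = 0" "coeff p (Suc (Suc (Suc m))) = 0"
    using m by (simp_all add: coeff_eq_0)
  have "coeff (u * pderiv p) (Suc (Suc m)) = - l21 * (of_nat (Suc m) * coeff p (Suc m))"
    by (simp add: u_def coeff_pderiv high del: of_nat_Suc)
  moreover have "coeff (smult (- of_nat n) ([:l22, l21:] * p)) (Suc (Suc m)) = - of_nat n * (l21 * coeff p (Suc m))"
    by (simp add: high)
  ultimately have "l21 * (of_nat n - of_nat (Suc m)) * coeff p (Suc m) = 0"
    unfolding rel by (simp add: algebra_simps)
  moreover have "of_nat n - of_nat (Suc m) = (1 :: complex)" using deg m by (simp flip: deg)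
  ultimately have "l21 = 0" using top by (metis mult_eq_0_iff mult_1_right)
  then have "degree u \<le> 1" by (simp add: u_def)
  then show False using pu deg n by linarith
qed

text \<open>Here \<open>n\<close> is the order of \<open>f\<close>. A multiple root \<open>c\<close>
  is treated in its chart; a degree drop of at least two means that \<open>y ^ 2\<close> divides the
  initial form, and exchanging the variables leads to the chart with \<open>c = 0\<close>.\<close>

lemma square_factor:
  assumes f: "convergent_near_0 f" "f \<noteq> 0" "vanishes_below 3 f"
    and v: "vanishes_below 1 \<alpha>" "vanishes_below 1 \<beta>" "vanishes_below 1 g"
    and eq: "\<alpha> * formal_dx f + \<beta> * formal_dy f = g * f"
    and L: "\<not> nilpotent_linear_part \<alpha> \<beta>"
  obtains p Q where "convergent_near_0 p" "convergent_near_0 Q" "f = Q * p ^ 2" "p $ 0 $ 0 = 0"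
proof -
  obtain n where n: "vanishes_below n f" "\<not> vanishes_below (Suc n) f"
  proof -
    obtain j i where "f $ j $ i \<noteq> 0" using f(2) by (metis fps_ext fps_zero_nth)
    then have "\<not> vanishes_below (Suc (i + j)) f" by (auto simp: vanishes_below_def)
    moreover have "vanishes_below 0 f" by (simp add: vanishes_below_def)
    ultimately show ?thesis
      using ex_least_nat_less[of "\<lambda>k. \<not> vanishes_below k f"] that by fastforce
  qed
  then obtain i j where ij: "i + j = n" "f $ j $ i \<noteq> 0"
    unfolding vanishes_below_def by (metis less_antisym)
  have "n \<ge> 3"
  proof (rule ccontr)
    assume "\<not> n \<ge> 3"
    then show False using f(3) ij by (simp add: vanishes_below_def)
  qed
  have "coeff (dehomogenize n f) i \<noteq> 0" using ij by (auto simp: coeff_dehomogenize)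
  then have p0: "dehomogenize n f \<noteq> 0" by auto
  from multiple_direction_cases[OF \<open>n \<ge> 3\<close> n(1) v eq p0 L] show ?thesis
  proof (elim disjE exE conjE)
    fix c assume "poly (dehomogenize n f) c = 0" "poly (pderiv (dehomogenize n f)) c = 0"
    then have dbl: "blowup c f $ n $ 0 = 0" "blowup c f $ n $ 1 = 0"
      unfolding blowup_nth_0 blowup_nth_1 by auto
    have ne: "blowup c f $ n \<noteq> 0" using p0 by (simp add: blowup_nth_eq_0_iff)
    have "blowup c \<beta> $ 1 $ 0 \<noteq> 0" using double_direction_regular[OF n(1) v eq ne dbl] L by blast
    from square_factor_of_double_direction[OF f(1) n(1) v eq ne dbl this] that show ?thesis by blast
  next
    assume deg: "degree (dehomogenize n f) + 2 \<le> n"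
    let ?s = swap_xy
    have v': "vanishes_below 1 (?s \<beta>)" "vanishes_below 1 (?s \<alpha>)" "vanishes_below 1 (?s g)"
      using v by (simp_all add: vanishes_below_swap_xy)
    have n': "vanishes_below n (?s f)" using n by (simp add: vanishes_below_swap_xy)
    have eq': "?s \<beta> * formal_dx (?s f) + ?s \<alpha> * formal_dy (?s f) = ?s g * ?s f"
      using arg_cong[OF eq, of ?s]
      by (simp add: swap_xy_add swap_xy_mult swap_xy_dx swap_xy_dy add.commute)
    have co: "coeff (dehomogenize n (?s f)) l = coeff (dehomogenize n f) (n - l)" if "l \<le> n" for l
      using that by (simp add: coeff_dehomogenize)
    have ne: "blowup 0 (?s f) $ n \<noteq> 0"
    proof -
      have "coeff (dehomogenize n (?s f)) j \<noteq> 0" using ij by (auto simp: coeff_dehomogenize)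
      then show ?thesis by (auto simp: blowup_nth_eq_0_iff)
    qed
    have "coeff (dehomogenize n (?s f)) l = 0" if "l < 2" for l
      using that co[of l] deg \<open>n \<ge> 3\<close> by (simp add: coeff_eq_0)
    then have dbl: "blowup 0 (?s f) $ n $ 0 = 0" "blowup 0 (?s f) $ n $ 1 = 0"
      unfolding blowup_nth_0 blowup_nth_1 by (simp_all add: poly_0_coeff_0 coeff_pderiv)
    have "\<not> nilpotent_linear_part (?s \<beta>) (?s \<alpha>)"
      using L by (auto simp: nilpotent_linear_part_def algebra_simps)
    then have "blowup 0 (?s \<alpha>) $ 1 $ 0 \<noteq> 0"
      using double_direction_regular[OF n' v' eq' ne dbl] by blast
    then obtain p Q where "convergent_near_0 p" "convergent_near_0 Q" "?s f = Q * p ^ 2" "p $ 0 $ 0 = 0"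
      using square_factor_of_double_direction[OF convergent_swap_xy[OF f(1)] n' v' eq' ne dbl] by blast
    moreover from this(3) have "f = ?s Q * ?s p ^ 2"
      by (metis swap_xy_swap_xy swap_xy_mult power2_eq_square)
    ultimately show ?thesis using that[of "?s p" "?s Q"] convergent_swap_xy by simp
  qed
qed

subsection \<open>Topological nilpotency\<close>

lemma vanishes_below_0 [simp]: "vanishes_below 0 h"
  by (simp add: vanishes_below_def)

lemma vanishes_below_zero [simp]: "vanishes_below k 0"
  by (simp add: vanishes_below_def)

lemma vanishes_below_add: "vanishes_below k g \<Longrightarrow> vanishes_below k h \<Longrightarrow> vanishes_below k (g + h)"
  by (simp add: vanishes_below_def)

lemma vanishes_below_mult:
  assumes "vanishes_below k g" "vanishes_below l h"
  shows "vanishes_below (k + l) (g * h)"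
  unfolding vanishes_below_def formal_mult_nth
proof (intro allI impI sum.neutral ballI)
  fix i j a b assume "i + j < k + l" "b \<in> {0..j}" "a \<in> {0..i}"
  then have "a + b < k \<or> (i - a) + (j - b) < l" by auto
  then show "g $ b $ a * h $ (j - b) $ (i - a) = 0"
    using assms by (auto simp: vanishes_below_def)
qed

lemma vanishes_below_mult_left: "vanishes_below k h \<Longrightarrow> vanishes_below k (g * h)"
  using vanishes_below_mult[of 0 g k h] by simp

lemma vanishes_below_dx: "vanishes_below (Suc k) h \<Longrightarrow> vanishes_below k (formal_dx h)"
  by (simp add: vanishes_below_def formal_dx_nth)

lemma vanishes_below_dy: "vanishes_below (Suc k) h \<Longrightarrow> vanishes_below k (formal_dy h)"
  by (auto simp: vanishes_below_def fps_of_nat[symmetric])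

lemma vanishes_below_x: "vanishes_below 1 formal_x"
  by (simp add: vanishes_below_def formal_x_def)

lemma vanishes_below_y: "vanishes_below 1 formal_y"
  by (simp add: vanishes_below_def formal_y_def)

lemma vanishes_below_decomposition:
  assumes "vanishes_below (Suc k) h"
  obtains u v where "h = formal_x * u + formal_y * v" "vanishes_below k u" "vanishes_below k v"
proof
  have "h $ 0 $ 0 = 0" using assms by (simp add: vanishes_below_def)
  then show "h = formal_x * fps_const (fps_shift 1 (h $ 0)) + formal_y * fps_shift 1 h"
    using formal_decomposition[of h] by (simp add: formal_const_def)
  show "vanishes_below k (fps_const (fps_shift 1 (h $ 0)))" "vanishes_below k (fps_shift 1 h)"
    using assms by (auto simp: vanishes_below_def)
qed

lemma ideal_gen_base: "a \<in> S \<Longrightarrow> a \<in> ideal_gen S"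
  unfolding ideal_gen_def by (rule module.span_base[OF module_times])

lemma ideal_gen_add: "a \<in> ideal_gen S \<Longrightarrow> b \<in> ideal_gen S \<Longrightarrow> a + b \<in> ideal_gen S"
  unfolding ideal_gen_def by (rule module.span_add[OF module_times])

lemma ideal_gen_induct:
  assumes "a \<in> ideal_gen S" "P 0" "\<And>a b. P a \<Longrightarrow> P b \<Longrightarrow> P (a + b)" "\<And>c a. P a \<Longrightarrow> P (c * a)"
    "\<And>a. a \<in> S \<Longrightarrow> P a"
  shows "P a"
proof -
  have "ideal_gen S \<subseteq> Collect P"
    unfolding ideal_gen_def
    by (rule module.span_minimal[OF module_times])
       (use assms in \<open>auto simp: module.subspace_def[OF module_times]\<close>)
  then show ?thesis using assms(1) by blast
qed

lemma formal_max_ideal_power: "vanishes_below k h \<Longrightarrow> h \<in> ideal_power formal_max_ideal k"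
proof (induction k arbitrary: h)
  case (Suc k)
  obtain u v where h: "h = formal_x * u + formal_y * v" and "vanishes_below k u" "vanishes_below k v"
    using vanishes_below_decomposition[OF Suc.prems] by blast
  then have uv: "u \<in> ideal_power formal_max_ideal k" "v \<in> ideal_power formal_max_ideal k"
    using Suc.IH by auto
  have "formal_x \<in> formal_max_ideal" "formal_y \<in> formal_max_ideal"
    unfolding formal_max_ideal_def by (auto intro: ideal_gen_base)
  with uv show ?case
    unfolding h ideal_power.simps by (intro ideal_gen_add ideal_gen_base) blast+
qed simp

lemma max_ideal_vanishes: "a \<in> max_ideal \<Longrightarrow> vanishes_below 1 (to_formal a)"
  unfolding max_ideal_def
  by (erule ideal_gen_induct)
     (auto intro: vanishes_below_add vanishes_below_mult_left vanishes_below_x vanishes_below_y simp del: One_nat_def)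

lemma max_ideal_power_vanishes: "a \<in> ideal_power max_ideal k \<Longrightarrow> vanishes_below k (to_formal a)"
proof (induction k arbitrary: a)
  case (Suc k)
  from Suc.prems show ?case
    unfolding ideal_power.simps
  proof (rule ideal_gen_induct)
    fix a assume "a \<in> {a * b |a b. a \<in> max_ideal \<and> b \<in> ideal_power max_ideal k}"
    then show "vanishes_below (Suc k) (to_formal a)"
      using vanishes_below_mult[OF max_ideal_vanishes Suc.IH] by auto
  qed (auto intro: vanishes_below_add vanishes_below_mult_left)
qed simp

section \<open>Vector fields whose linear part has square zero\<close>

locale singular_vector_field =
  fixes \<alpha> \<beta> :: formal_series
  assumes \<alpha>: "vanishes_below 1 \<alpha>" and \<beta>: "vanishes_below 1 \<beta>"
    and nilpotent: "nilpotent_linear_part \<alpha> \<beta>"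
begin

definition D :: "formal_series \<Rightarrow> formal_series" where
  "D h = \<alpha> * formal_dx h + \<beta> * formal_dy h"

lemma D_add: "D (g + h) = D g + D h"
  by (simp add: D_def algebra_simps)

lemma D_mult: "D (g * h) = g * D h + h * D g"
  by (simp add: D_def algebra_simps)

lemma D_power_add: "(D ^^ r) (g + h) = (D ^^ r) g + (D ^^ r) h"
  by (induction r) (simp_all add: D_add)

lemma D_vanishes_1: "vanishes_below 1 (D h)"
  unfolding D_def using vanishes_below_mult_left[OF \<alpha>, of "formal_dx h"]
    vanishes_below_mult_left[OF \<beta>, of "formal_dy h"]
  by (simp add: vanishes_below_add mult.commute)

lemma D_vanishes: "vanishes_below k h \<Longrightarrow> vanishes_below k (D h)"
proof (cases k)
  case (Suc l)
  assume "vanishes_below k h"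
  then show ?thesis
    using vanishes_below_mult[OF \<alpha> vanishes_below_dx, of l h]
      vanishes_below_mult[OF \<beta> vanishes_below_dy, of l h]
    unfolding D_def Suc by (simp add: vanishes_below_add)
qed simp

lemma D_power_vanishes: "vanishes_below k h \<Longrightarrow> vanishes_below k ((D ^^ r) h)"
  by (induction r) (simp_all add: D_vanishes)

text \<open>The linear coefficients of \<open>D \<alpha>\<close> and \<open>D \<beta>\<close> are
  the entries of the square of the linear part.\<close>

lemma D_D_linear:
  assumes "g = \<alpha> \<or> g = \<beta>"
  shows "vanishes_below 2 (D g)"
proof -
  have z: "\<alpha> $ 0 $ 0 = 0" "\<beta> $ 0 $ 0 = 0" using \<alpha> \<beta> by (auto simp: vanishes_below_def)
  have "D g $ 0 $ 0 = 0" using z by (simp add: D_def)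
  moreover have "D g $ 0 $ 1 = 0" "D g $ 1 $ 0 = 0"
    using assms nilpotent z unfolding nilpotent_linear_part_def
    by (auto simp: D_def formal_mult_nth formal_dx_nth algebra_simps)
  ultimately show ?thesis
    unfolding vanishes_below_def by (auto simp: numeral_2_eq_2 less_Suc_eq add_is_1)
qed

lemma D_D_vanishes_2: "vanishes_below 2 (D (D h))"
proof -
  let ?x = "formal_dx h" and ?y = "formal_dy h"
  have "D (D h) = ?x * D \<alpha> + \<alpha> * D ?x + (?y * D \<beta> + \<beta> * D ?y)"
    unfolding D_def[of h] D_add D_mult by (simp add: algebra_simps)
  moreover have "vanishes_below 2 (\<alpha> * D ?x)" "vanishes_below 2 (\<beta> * D ?y)"
    using vanishes_below_mult[OF \<alpha> D_vanishes_1] vanishes_below_mult[OF \<beta> D_vanishes_1]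
    by (simp_all add: numeral_2_eq_2)
  ultimately show ?thesis
    by (simp add: vanishes_below_add vanishes_below_mult_left D_D_linear)
qed

text \<open>Modulo order \<open>k + 2\<close> the factor \<open>g\<close> behaves like a constant of
  \<open>D\<close>: each Leibniz term \<open>h * D g\<close> already has order \<open>k + 2\<close>,
  and \<open>D\<close> preserves this.\<close>

lemma D_power_mult_vanishes_aux:
  assumes g: "vanishes_below 1 g" "vanishes_below 2 (D g)"
  shows "vanishes_below k h \<Longrightarrow> vanishes_below (k + 1) ((D ^^ r) h)
    \<Longrightarrow> vanishes_below (k + 2) ((D ^^ r) (g * h))"
proof (induction r arbitrary: h)
  case 0
  then show ?case using vanishes_below_mult[OF g(1), of "k + 1" h] by simp
next
  case (Suc r)
  have "(D ^^ Suc r) (g * h) = (D ^^ r) (g * D h) + (D ^^ r) (h * D g)"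
    by (simp add: funpow_Suc_right D_mult D_power_add del: funpow.simps)
  moreover have "vanishes_below (k + 2) ((D ^^ r) (g * D h))"
    using Suc by (intro Suc.IH D_vanishes) (simp_all add: funpow_Suc_right del: funpow.simps)
  moreover have "vanishes_below (k + 2) ((D ^^ r) (h * D g))"
    by (intro D_power_vanishes vanishes_below_mult Suc g)
  ultimately show ?case by (simp add: vanishes_below_add del: funpow.simps)
qed

text \<open>Modulo order \<open>k + 2\<close>, at most one \<open>D\<close> in the Leibniz expansion
  falls on \<open>g\<close>, since \<open>D (D g)\<close> has order two; so at least
  \<open>r\<close> of them fall on \<open>h\<close>. The auxiliary lemma handles the terms where one
  has fallen on \<open>g\<close>.\<close>

lemma D_power_mult_vanishes:
  assumes g: "vanishes_below 1 g"
  shows "vanishes_below k h \<Longrightarrow> vanishes_below (k + 1) ((D ^^ r) h)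
    \<Longrightarrow> vanishes_below (k + 2) ((D ^^ Suc r) (g * h))"
proof (induction r arbitrary: h)
  case 0
  then show ?case
    using vanishes_below_mult[OF g D_vanishes, of "k + 1" h]
      vanishes_below_mult[OF _ D_vanishes_1[of g], of "k + 1" h]
    by (simp add: D_mult vanishes_below_add)
next
  case (Suc r)
  have "(D ^^ Suc (Suc r)) (g * h) = (D ^^ Suc r) (g * D h) + (D ^^ Suc r) (D g * h)"
    unfolding funpow_Suc_right[of "Suc r"] by (simp add: D_mult D_power_add D_add mult.commute)
  moreover have "vanishes_below (k + 2) ((D ^^ Suc r) (g * D h))"
    using Suc by (intro Suc.IH D_vanishes) (simp_all add: funpow_Suc_right del: funpow.simps)
  moreover have "vanishes_below (k + 2) ((D ^^ Suc r) (D g * h))"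
    by (intro D_power_mult_vanishes_aux D_vanishes_1 D_D_vanishes_2 Suc)
  ultimately show ?case by (simp add: vanishes_below_add del: funpow.simps)
qed

text \<open>For order 0 one application suffices. Writing \<open>h\<close> as a combination of x and
  y with coefficients of order \<open>k\<close>, the extra linear factor costs one more application
  of \<open>D\<close>.\<close>

lemma D_power_raises_order: "vanishes_below k h \<Longrightarrow> vanishes_below (Suc k) ((D ^^ Suc k) h)"
proof (induction k arbitrary: h)
  case 0
  then show ?case using D_vanishes_1 by simp
next
  case (Suc k)
  obtain u v where h: "h = formal_x * u + formal_y * v" and uv: "vanishes_below k u" "vanishes_below k v"
    using vanishes_below_decomposition[OF Suc.prems] by blast
  have "vanishes_below (k + 2) ((D ^^ Suc (Suc k)) (formal_x * u))"
    "vanishes_below (k + 2) ((D ^^ Suc (Suc k)) (formal_y * v))"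
    using D_power_mult_vanishes[OF vanishes_below_x uv(1), of "Suc k"] Suc.IH[OF uv(1)]
      D_power_mult_vanishes[OF vanishes_below_y uv(2), of "Suc k"] Suc.IH[OF uv(2)]
    by (simp_all del: funpow.simps)
  then show ?case
    unfolding h D_power_add by (simp add: vanishes_below_add del: funpow.simps)
qed

lemma eventually_D_power_vanishes: "\<exists>M. \<forall>m\<ge>M. \<forall>h. vanishes_below k ((D ^^ m) h)"
proof (induction k)
  case (Suc k)
  then obtain M where M: "\<And>m h. m \<ge> M \<Longrightarrow> vanishes_below k ((D ^^ m) h)" by blast
  have "vanishes_below (Suc k) ((D ^^ m) h)" if "m \<ge> M + Suc k" for m h
  proof -
    have "(D ^^ m) h = (D ^^ Suc k) ((D ^^ (m - Suc k)) h)"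
      using that funpow_add[of "Suc k" "m - Suc k" D] by simp
    then show ?thesis using D_power_raises_order[OF M[of "m - Suc k" h]] that by simp
  qed
  then show ?case by blast
qed simp

end

section \<open>From abstract derivations to coefficient vector fields\<close>

text \<open>Both sides are derivations of the formal series with equal values at x and y, so their
  difference vanishes by \<open>twisted_derivation_eq_0\<close>.\<close>

lemma formal_extension_eq:
  assumes "\<delta> \<in> Der"
  defines "\<alpha> \<equiv> to_formal (\<delta> conv_x)" and "\<beta> \<equiv> to_formal (\<delta> conv_y)"
  shows "formal_extension \<delta> h = \<alpha> * formal_dx h + \<beta> * formal_dy h"
    and "to_formal (\<delta> g) = \<alpha> * formal_dx (to_formal g) + \<beta> * formal_dy (to_formal g)"
proof -
  have "derivation formal_const (formal_extension \<delta>)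
      \<and> (\<forall>h. formal_extension \<delta> (to_formal h) = to_formal (\<delta> h))"
    unfolding formal_extension_def by (rule theI'[OF formal_extension_ex1[OF assms(1)]])
  then have D: "derivation formal_const (formal_extension \<delta>)"
    and ext: "\<And>h. formal_extension \<delta> (to_formal h) = to_formal (\<delta> h)" by auto
  have xy: "formal_extension \<delta> formal_x = \<alpha>" "formal_extension \<delta> formal_y = \<beta>"
    using ext[of conv_x] ext[of conv_y] by (simp_all add: \<alpha>_def \<beta>_def)
  have one: "formal_const 1 = 1" by (simp add: formal_const_def)
  let ?E = "\<lambda>h. formal_extension \<delta> h - (\<alpha> * formal_dx h + \<beta> * formal_dy h)"
  have E: "?E h = 0" for h
  proof (rule twisted_derivation_eq_0[where E = ?E and \<iota> = "\<lambda>h. h"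
        and u = formal_x and v = formal_y and \<kappa> = formal_const])
    show "\<exists>c g1 g2. h = formal_const c + formal_x * g1 + formal_y * g2" for h
      using formal_decomposition by blast
    show "?E (formal_const c) = 0" for c
      using derivation_const_eq_0[OF D one] by simp
  qed (use D in \<open>simp_all add: derivation_def algebra_simps xy\<close>)
  show "formal_extension \<delta> h = \<alpha> * formal_dx h + \<beta> * formal_dy h" using E[of h] by simp
  then show "to_formal (\<delta> g) = \<alpha> * formal_dx (to_formal g) + \<beta> * formal_dy (to_formal g)"
    using E[of "to_formal g"] ext[of g] by simp
qed

lemma singular_Der_vanishes:
  assumes "\<delta> \<in> singular_Der"
  shows "vanishes_below 1 (to_formal (\<delta> h))"
proof -
  obtain n a \<eta> where \<delta>: "\<delta> = (\<lambda>h. \<Sum>k<n. a k * \<eta> k h)" and a: "\<forall>k<(n::nat). a k \<in> max_ideal \<and> \<eta> k \<in> Der"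
    using assms unfolding ideal_Der_def by blast
  have "vanishes_below 1 (to_formal (\<Sum>k<m. a k * \<eta> k h))" if "m \<le> n" for m
    using that
  proof (induction m)
    case (Suc m)
    then have "vanishes_below 1 (to_formal (a m))" using a by (intro max_ideal_vanishes) auto
    from vanishes_below_mult_left[OF this, of "to_formal (\<eta> m h)"] Suc show ?case
      by (simp add: vanishes_below_add mult.commute)
  qed simp
  then show ?thesis unfolding \<delta> by simp
qed

lemma conv_unit_constant_coeff:
  assumes "p dvd 1"
  shows "to_formal p $ 0 $ 0 \<noteq> 0"
proof -
  obtain q where "1 = p * q" using assms by blast
  from arg_cong[OF this, of "\<lambda>h. to_formal h $ 0 $ 0"] show ?thesis by auto
qed

text \<open>Both factors must converge, because squarefreeness concerns divisibility among
  convergent series. A unit there has nonzero constant coefficient.\<close>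

lemma squarefree_no_square_factor:
  assumes "squarefree f" "convergent_near_0 p" "convergent_near_0 Q" "to_formal f = Q * p ^ 2"
  shows "p $ 0 $ 0 \<noteq> 0"
proof -
  have t: "to_formal (Abs_conv_series p) = p" "to_formal (Abs_conv_series Q) = Q"
    using assms(2,3) by (simp_all add: Abs_conv_series_inverse)
  have "to_formal f = to_formal (Abs_conv_series p ^ 2 * Abs_conv_series Q)"
    by (simp add: power2_eq_square t assms(4) mult.commute)
  then have "f = Abs_conv_series p ^ 2 * Abs_conv_series Q" by (simp only: to_formal_inject)
  then have "Abs_conv_series p ^ 2 dvd f" by simp
  then have "Abs_conv_series p dvd 1" using assms(1) by (simp add: squarefree_def)
  from conv_unit_constant_coeff[OF this] show ?thesis by (simp add: t)
qed

theorem proposition5p2: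
  fixes f :: conv_series and \<delta> :: "conv_series \<Rightarrow> conv_series"
  assumes "squarefree f"
    and "\<not> is_product f"
    and "f \<in> ideal_power max_ideal 3"
    and "\<delta> \<in> singular_Der" and "\<delta> \<in> log_Der f"
    and "\<delta> f \<in> {g * f | g. g \<in> max_ideal}"
  shows "topologically_nilpotent \<delta>"
proof -
  let ?\<alpha> = "to_formal (\<delta> conv_x)" and ?\<beta> = "to_formal (\<delta> conv_y)"
  have Der: "\<delta> \<in> Der" using assms(5) by (simp add: log_Der_def)
  note v = singular_Der_vanishes[OF assms(4)]
  obtain g where g: "g \<in> max_ideal" "\<delta> f = g * f" using assms(6) by blast
  have eq: "?\<alpha> * formal_dx (to_formal f) + ?\<beta> * formal_dy (to_formal f) = to_formal g * to_formal f"
    using formal_extension_eq(2)[OF Der, of f] g by simp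
  have conv: "convergent_near_0 (to_formal f)" using to_formal[of f] by simp
  have nz: "to_formal f \<noteq> 0"
  proof
    assume "to_formal f = 0"
    \<comment> \<open>Zero is a multiple of the square of the nonunit x.\<close>
    then have "to_formal f = 0 * formal_x ^ 2" by simp
    from squarefree_no_square_factor[OF assms(1) convergent_near_0_x convergent_near_0_0 this]
    show False by (simp add: formal_x_def)
  qed
  have "nilpotent_linear_part ?\<alpha> ?\<beta>"
  proof (rule ccontr)
    assume "\<not> nilpotent_linear_part ?\<alpha> ?\<beta>"
    then obtain p Q where "convergent_near_0 p" "convergent_near_0 Q" "to_formal f = Q * p ^ 2" "p $ 0 $ 0 = 0"
      using square_factor[OF conv nz max_ideal_power_vanishes[OF assms(3)] v v max_ideal_vanishes[OF g(1)] eq]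
      by blast
    then show False using squarefree_no_square_factor[OF assms(1)] by blast
  qed
  then interpret singular_vector_field ?\<alpha> ?\<beta>
    by unfold_locales (rule v)+
  have "formal_extension \<delta> = D"
    using formal_extension_eq(1)[OF Der] by (auto simp: D_def)
  moreover have "\<forall>\<^sub>F m in sequentially. (D ^^ m) h \<in> ideal_power formal_max_ideal k" for h k
    using eventually_D_power_vanishes[of k] formal_max_ideal_power
    unfolding eventually_sequentially by blast
  ultimately show ?thesis by (simp add: topologically_nilpotent_def)
qed

end
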